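(* Let $F=(F_1,\dots,F_m):\mathbb{R}^n\to\mathbb{R}^m$ be twice continuously differentiable, and let $\{x^k\}$ be an infinite sequence generated by the BFGS-type Algorithm described in the context, with no $x^k$ Pareto critical. Assume: (a) $\{x^k\}$ converges to a local Pareto optimal point $x^*$ of $F$ at which $\nabla^2F_j(x^* )$ is positive definite for all $j=1,\dots,m$; (b) there exist $\nu\in(0,1]$ and $M>0$ such that $\|\nabla^2F_j(x)-\nabla^2F_j(x^* )\|\le M\|x-x^*\|^\nu$ for all $j=1,\dots,m$ and all $x$ in a neighborhood of $x^*$; (c) $\sum_{k\ge0}r_j^k<\infty$ for each $j=1,\dots,m$. Then the step size $\alpha_k=1$ is admissible for all sufficiently large $k$, i.e. for all sufficiently large $k$, $$F_j(x^k+d^k)\le F_j(x^k)+\rho\,\mathcal{D}(x^k,d^k)\quad\forall j=1,\dots,m,\qquad \mathcal{D}(x^k+d^k,d^k)\ge\sigma\,\mathcal{D}(x^k,d^k),$$ and $\{x^k\}$ converges to $x^*$ at a superlinear rate, i.e. $\displaystyle\lim_{k\to\infty}\frac{\|x^{k+1}-x^*\|}{\|x^k-x^*\|}=0$.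
   Context: Notation. $\|\cdot\|$ is the Euclidean norm (and induced matrix norm); $\Delta_m:=\{\lambda\in\mathbb{R}^m:\lambda_j\ge 0\ \forall j,\ \sum_{j=1}^m\lambda_j=1\}$; $B\succ0$ means symmetric positive definite. Put $\mathcal{D}(x,d):=\max_{j=1,\dots,m}\nabla F_j(x)^\top d$. A point $x$ is Pareto critical if there is no $d\in\mathbb{R}^n$ with $\nabla F_j(x)^\top d<0$ for all $j=1,\dots,m$. A point $x^*$ is local Pareto optimal if there is a neighborhood $V$ of $x^*$ such that no $x\in V$ satisfies $F_j(x)\le F_j(x^* )$ for all $j$ and $F(x)\ne F(x^* )$. Algorithm. Data: $\rho\in(0,1/2)$, $\sigma\in(\rho,1)$, $0<\underline{\vartheta}\le\bar{\vartheta}$, $x^0\in\mathbb{R}^n$, and matrices $B_j^0\succ0$ in $\mathbb{R}^{n\times n}$, $j=1,\dots,m$. For $k=0,1,2,\dots$: Step 1: let $d^k$ be the unique minimizer over $d\in\mathbb{R}^n$ of $\max_{j=1,\dots,m}\nabla F_j(x^k)^\top d+\tfrac12 d^\top B_j^k d$. Step 2: if $x^k$ is Pareto critical, stop. Step 3: compute a step size $\alpha_k>0$ (trying first $\alpha_k=1$, i.e. $\alpha_k=1$ is taken whenever it satisfies both conditions) such that $F_j(x^k+\alpha_kd^k)\le F_j(x^k)+\rho\alpha_k\mathcal{D}(x^k,d^k)$ for all $j=1,\dots,m$, and $\mathcal{D}(x^k+\alpha_kd^k,d^k)\ge\sigma\mathcal{D}(x^k,d^k)$; set $x^{k+1}:=x^k+\alpha_kd^k$.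 Step 4: set $s^k:=x^{k+1}-x^k$, $y_j^k:=\nabla F_j(x^{k+1})-\nabla F_j(x^k)$, $\eta_j^k:=(y_j^k)^\top s^k/\|s^k\|^2$; choose arbitrary $\mu^k\in\Delta_m$ and $\vartheta_k\in[\underline{\vartheta},\bar{\vartheta}]$; set $r_j^k:=\max\{-\eta_j^k,0\}+\vartheta_k\big\|\sum_{i=1}^m\mu_i^k\nabla F_i(x^k)\big\|$ and $\gamma_j^k:=y_j^k+r_j^ks^k$ for $j=1,\dots,m$. Step 5: for $j=1,\dots,m$ set $B_j^{k+1}:=B_j^k-\dfrac{B_j^ks^k(s^k)^\top B_j^k}{(s^k)^\top B_j^ks^k}+\dfrac{\gamma_j^k(\gamma_j^k)^\top}{(\gamma_j^k)^\top s^k}$. *)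

theory Defs
  imports "HOL-Analysis.Analysis"
begin

definition grad :: "(real^'n \<Rightarrow> real) \<Rightarrow> real^'n \<Rightarrow> real^'n" where
  "grad f x = (THE g. GDERIV f x :> g)"

definition hessian :: "(real^'n \<Rightarrow> real) \<Rightarrow> real^'n \<Rightarrow> real^'n^'n" where
  "hessian f x = jacobian (grad f) (at x)"

definition twice_cont_differentiable :: "(real^'n \<Rightarrow> real) \<Rightarrow> bool" where
  "twice_cont_differentiable f \<longleftrightarrow>
     (\<forall>x. f differentiable (at x)) \<and> (\<forall>x. grad f differentiable (at x)) \<and>
     continuous_on UNIV (hessian f)"

definition pos_def :: "real^'n^'n \<Rightarrow> bool" where
  "pos_def A \<longleftrightarrow> transpose A = A \<and> (\<forall>v. v \<noteq> 0 \<longrightarrow> 0 < v \<bullet> (A *v v))"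

text \<open>The norm of the type of matrices is the Frobenius norm, hence the operator norm is spelled out.\<close>

definition matrix_onorm :: "real^'n^'n \<Rightarrow> real" where
  "matrix_onorm A = onorm (\<lambda>v. A *v v)"

definition outer :: "real^'n \<Rightarrow> real^'n \<Rightarrow> real^'n^'n" where
  "outer u v = (\<chi> i j. u $ i * v $ j)"

definition std_simplex :: "(real^'m) set" where
  "std_simplex = {l. (\<forall>j. 0 \<le> l $ j) \<and> (\<Sum>j\<in>UNIV. l $ j) = 1}"

text \<open>The components of \<open>F :: real^'n \<Rightarrow> real^'m\<close> are the maps \<open>\<lambda>x. F x $ j\<close>, with \<open>j\<close> ranging over
  the finite, nonempty index type \<open>'m\<close>.\<close>

definition cgrad :: "(real^'n \<Rightarrow> real^'m) \<Rightarrow> 'm \<Rightarrow> real^'n \<Rightarrow> real^'n" where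
  "cgrad F j = grad (\<lambda>x. F x $ j)"

definition chess :: "(real^'n \<Rightarrow> real^'m) \<Rightarrow> 'm \<Rightarrow> real^'n \<Rightarrow> real^'n^'n" where
  "chess F j = hessian (\<lambda>x. F x $ j)"

definition maxdir :: "(real^'n \<Rightarrow> real^'m) \<Rightarrow> real^'n \<Rightarrow> real^'n \<Rightarrow> real" where
  "maxdir F x d = (MAX j. cgrad F j x \<bullet> d)"

definition pareto_critical :: "(real^'n \<Rightarrow> real^'m) \<Rightarrow> real^'n \<Rightarrow> bool" where
  "pareto_critical F x \<longleftrightarrow> \<not> (\<exists>d. \<forall>j. cgrad F j x \<bullet> d < 0)"

definition local_pareto_optimal :: "(real^'n \<Rightarrow> real^'m) \<Rightarrow> real^'n \<Rightarrow> bool" where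
  "local_pareto_optimal F z \<longleftrightarrow>
     (\<exists>V. open V \<and> z \<in> V \<and> \<not> (\<exists>x\<in>V. (\<forall>j. F x $ j \<le> F z $ j) \<and> F x \<noteq> F z))"

definition subproblem_obj ::
    "(real^'n \<Rightarrow> real^'m) \<Rightarrow> ('m \<Rightarrow> real^'n^'n) \<Rightarrow> real^'n \<Rightarrow> real^'n \<Rightarrow> real" where
  "subproblem_obj F B x d = (MAX j. cgrad F j x \<bullet> d + 1/2 * (d \<bullet> (B j *v d)))"

definition admissible_step ::
    "(real^'n \<Rightarrow> real^'m) \<Rightarrow> real \<Rightarrow> real \<Rightarrow> real^'n \<Rightarrow> real^'n \<Rightarrow> real \<Rightarrow> bool" where
  "admissible_step F \<rho> \<sigma> x d a \<longleftrightarrow>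
     (\<forall>j. F (x + a *\<^sub>R d) $ j \<le> F x $ j + \<rho> * a * maxdir F x d) \<and>
     maxdir F (x + a *\<^sub>R d) d \<ge> \<sigma> * maxdir F x d"

definition step_s :: "(nat \<Rightarrow> real^'n) \<Rightarrow> nat \<Rightarrow> real^'n" where
  "step_s x k = x (Suc k) - x k"

definition grad_diff :: "(real^'n \<Rightarrow> real^'m) \<Rightarrow> (nat \<Rightarrow> real^'n) \<Rightarrow> nat \<Rightarrow> 'm \<Rightarrow> real^'n" where
  "grad_diff F x k j = cgrad F j (x (Suc k)) - cgrad F j (x k)"

definition curv_eta :: "(real^'n \<Rightarrow> real^'m) \<Rightarrow> (nat \<Rightarrow> real^'n) \<Rightarrow> nat \<Rightarrow> 'm \<Rightarrow> real" where
  "curv_eta F x k j = (grad_diff F x k j \<bullet> step_s x k) / (norm (step_s x k))\<^sup>2"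

definition reg_r ::
    "(real^'n \<Rightarrow> real^'m) \<Rightarrow> (nat \<Rightarrow> real^'n) \<Rightarrow> (nat \<Rightarrow> real^'m) \<Rightarrow> (nat \<Rightarrow> real) \<Rightarrow> nat \<Rightarrow> 'm \<Rightarrow> real" where
  "reg_r F x \<mu> \<theta> k j =
     max (- curv_eta F x k j) 0 + \<theta> k * norm (\<Sum>i\<in>UNIV. (\<mu> k $ i) *\<^sub>R cgrad F i (x k))"

definition gamma_vec ::
    "(real^'n \<Rightarrow> real^'m) \<Rightarrow> (nat \<Rightarrow> real^'n) \<Rightarrow> (nat \<Rightarrow> real^'m) \<Rightarrow> (nat \<Rightarrow> real) \<Rightarrow> nat \<Rightarrow> 'm \<Rightarrow> real^'n" where
  "gamma_vec F x \<mu> \<theta> k j = grad_diff F x k j + reg_r F x \<mu> \<theta> k j *\<^sub>R step_s x k"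

definition bfgs_update :: "real^'n^'n \<Rightarrow> real^'n \<Rightarrow> real^'n \<Rightarrow> real^'n^'n" where
  "bfgs_update B s g =
     B - (1 / (s \<bullet> (B *v s))) *\<^sub>R (B ** outer s s ** B) + (1 / (g \<bullet> s)) *\<^sub>R outer g g"

text \<open>An infinite run: the stopping test never succeeds, and all choices left open by the algorithm
  (\<open>\<alpha>\<close>, \<open>\<mu>\<close>, \<open>\<theta>\<close>) are arbitrary sequences satisfying its requirements.  For positive definite
  \<open>B k j\<close> the objective of the subproblem is strongly convex, so that its minimizer is unique;
  accordingly only minimality of \<open>d k\<close> is demanded.\<close>

definition bfgs_run ::
    "(real^'n \<Rightarrow> real^'m) \<Rightarrow> real \<Rightarrow> real \<Rightarrow> real \<Rightarrow> real \<Rightarrow> (nat \<Rightarrow> real^'n) \<Rightarrow>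
     (nat \<Rightarrow> 'm \<Rightarrow> real^'n^'n) \<Rightarrow> (nat \<Rightarrow> real^'n) \<Rightarrow> (nat \<Rightarrow> real) \<Rightarrow> (nat \<Rightarrow> real^'m) \<Rightarrow>
     (nat \<Rightarrow> real) \<Rightarrow> bool" where
  "bfgs_run F \<rho> \<sigma> \<theta>min \<theta>max x B d \<alpha> \<mu> \<theta> \<longleftrightarrow>
     (\<forall>j. pos_def (B 0 j)) \<and>
     (\<forall>k.
        is_arg_min (subproblem_obj F (B k) (x k)) (\<lambda>_. True) (d k) \<and>
        \<not> pareto_critical F (x k) \<and>
        0 < \<alpha> k \<and> admissible_step F \<rho> \<sigma> (x k) (d k) (\<alpha> k) \<and>
        (admissible_step F \<rho> \<sigma> (x k) (d k) 1 \<longrightarrow> \<alpha> k = 1) \<and>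
        x (Suc k) = x k + \<alpha> k *\<^sub>R d k \<and>
        \<mu> k \<in> std_simplex \<and> \<theta> k \<in> {\<theta>min..\<theta>max} \<and>
        (\<forall>j. B (Suc k) j = bfgs_update (B k j) (step_s x k) (gamma_vec F x \<mu> \<theta> k j)))"

end

theory Submission
  imports Defs
begin

text \<open>
  Write \<open>G\<^sub>j\<close> for the Hessians at the limit \<open>x*\<close>, \<open>s\<close> for the current step and \<open>d\<close> for the
  current direction.  The proof follows the theory of Broyden, Dennis and More and of Byrd and Nocedal
  for the scalar BFGS method, with one change forced by several objectives: the multipliers of the
  direction subproblem differ from iteration to iteration, so no single scalarization of \<open>F\<close> can serve
  as a merit function.  The smallest component \<open>gap z\<close> of \<open>F z - F x*\<close> does.  It is at most every convex
  combination of the components, and the Armijo condition lowers all components, hence also the gap, by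
  at least the same amount.

  Positive definiteness of the \<open>G\<^sub>j\<close> makes every objective strongly convex near \<open>x*\<close>.  This gives
  \<open>\<parallel>s\<parallel>\<^sup>2 = O(gap)\<close> (\<open>eventually_step_le_gap\<close>) and \<open>gap z = O(\<parallel>\<Sum>\<^sub>j l\<^sub>j \<nabla>F\<^sub>j z\<parallel>\<^sup>2)\<close> for all convex
  weights \<open>l\<close> (\<open>eventually_gap_le_grad\<close>).  For the multipliers \<open>l\<close> of the subproblem the combination of
  gradients is \<open>- \<Sum>\<^sub>j l\<^sub>j B\<^sub>j d\<close>, so an iteration whose matrices are neither nearly singular nor huge along
  \<open>s\<close> decreases the gap by a constant factor (\<open>eventually_linear_decrease\<close>).

  The matrices are controlled by the potential \<open>tr (G\<^sup>-\<^sup>1 B) - ln \<bar>det B\<bar>\<close>, which is bounded below on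
  positive definite matrices (\<open>bfgs_potential_bounded_below\<close>).  An update changes it by
  \<open>- curvature_defect + secant_defect\<close> (\<open>bfgs_potential_update\<close>).  The first defect is nonnegative and
  measures how far \<open>B s\<close> is from \<open>G s\<close>; the second is at most proportional to the relative error of
  the secant equation \<open>\<gamma> = G s\<close>, that is, to the Hoelder error plus the regularization \<open>r\<close>.  Summation is
  used twice.  Since the secant errors tend to \<open>0\<close>, the curvature defects are bounded on average,
  the gap decreases by a constant factor at a fixed fraction of the iterations, and \<open>x\<close> converges
  R-linearly (\<open>linear_convergence\<close>).  Linear convergence makes the Hoelder errors summable, so now the
  curvature defects are summable, tend to \<open>0\<close>, and yield the Dennis--More condition
  \<open>\<parallel>(B\<^sub>j - G\<^sub>j) d\<parallel> = o(\<parallel>d\<parallel>)\<close> for every \<open>j\<close> (\<open>eventually_Dennis_More\<close>).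

  By this condition the subproblem is asymptotically the Newton subproblem, so unit steps are
  admissible (\<open>eventually_unit_step\<close>), and the gradients at the next iterate, combined with the present
  multipliers, are \<open>o(\<parallel>s\<parallel>)\<close>.  Hence the next gap is \<open>o(\<parallel>s\<parallel>\<^sup>2)\<close> and the next step \<open>o(\<parallel>s\<parallel>)\<close>
  (\<open>eventually_next_step_le\<close>), which is superlinear convergence.
\<close>

section \<open>Positive definite matrices\<close>

lemma outer_mult_vec [simp]: "outer u v *v w = (v \<bullet> w) *\<^sub>R u"
  by (simp add: vec_eq_iff outer_def matrix_vector_mult_def inner_vec_def sum_distrib_left mult_ac)

lemma matrix_mult_outer: "A ** outer u v = outer (A *v u) v"
  by (simp add: matrix_eq matrix_vector_mul_assoc [symmetric] matrix_vector_mult_scaleR)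

lemma outer_mult_matrix: "outer u v ** A = outer u (transpose A *v v)"
  by (simp add: matrix_eq matrix_vector_mul_assoc [symmetric] dot_lmul_matrix)

lemma matrix_add_rdistrib: "(A + B) ** C = A ** C + (B ** C :: real^'n^'m)"
  by (simp add: vec_eq_iff matrix_matrix_mult_def sum.distrib ring_distribs)

lemma matrix_mult_scaleR: "A ** (c *\<^sub>R B) = c *\<^sub>R (A ** (B :: real^'n^'m))"
  by (simp add: vec_eq_iff matrix_matrix_mult_def sum_distrib_left mult_ac)

lemma trace_outer [simp]: "trace (outer u v) = u \<bullet> v"
  by (simp add: trace_def outer_def inner_vec_def)

lemma trace_scaleR: "trace (c *\<^sub>R A) = c * trace (A :: real^'n^'n)"
  by (simp add: trace_def sum_distrib_left)

lemma symmetric_nth: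
  assumes "transpose A = A" shows "A $ i $ j = A $ j $ i"
proof -
  have "transpose A $ i $ j = A $ j $ i"
    by (simp add: transpose_def)
  then show ?thesis
    by (simp add: assms)
qed

lemma inner_matrix_vec_commute:
  fixes A :: "real^'n^'n"
  assumes "transpose A = A"
  shows "(A *v u) \<bullet> v = u \<bullet> (A *v v)"
  using assms dot_lmul_matrix[of u A v] vector_transpose_matrix[of u A] by simp

lemma pos_def_sym:
  assumes "pos_def A" shows "(A *v u) \<bullet> v = u \<bullet> (A *v v)"
  using assms inner_matrix_vec_commute pos_def_def by blast

lemma pos_def_pos: "pos_def A \<Longrightarrow> v \<noteq> 0 \<Longrightarrow> 0 < v \<bullet> (A *v v)"
  by (simp add: pos_def_def)

lemma pos_def_nonneg: "pos_def A \<Longrightarrow> 0 \<le> v \<bullet> (A *v v)"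
  by (cases "v = 0") (auto dest: pos_def_pos intro: less_imp_le)

lemma pos_def_eq_0: "pos_def A \<Longrightarrow> A *v v = 0 \<Longrightarrow> v = 0"
  using pos_def_pos by fastforce

lemma pos_def_invertible:
  assumes "pos_def A" shows "invertible A"
proof -
  have "inj ((*v) A)"
  proof (rule injI)
    fix u v assume "A *v u = A *v v"
    then have "A *v (u - v) = 0"
      by (simp add: matrix_vector_mult_diff_distrib)
    then show "u = v"
      using pos_def_eq_0[OF assms] by fastforce
  qed
  then show ?thesis
    by (simp add: invertible_left_inverse matrix_left_invertible_injective)
qed

lemma pos_def_det_nonzero: "pos_def A \<Longrightarrow> det A \<noteq> 0"
  using pos_def_invertible invertible_det_nz by blast

lemma pos_def_inv_cancel:
  assumes "pos_def A"
  shows "A *v (matrix_inv A *v v) = v" "matrix_inv A *v (A *v v) = v"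
proof -
  have "A ** matrix_inv A = mat 1 \<and> matrix_inv A ** A = mat 1"
    using pos_def_invertible[OF assms] unfolding invertible_def matrix_inv_def by (rule someI_ex)
  then show "A *v (matrix_inv A *v v) = v" "matrix_inv A *v (A *v v) = v"
    by (simp_all add: matrix_vector_mul_assoc)
qed

lemma pos_def_inverse:
  fixes A :: "real^'n^'n"
  assumes "pos_def A" shows "pos_def (matrix_inv A)"
  unfolding pos_def_def
proof (intro conjI allI impI)
  have "(matrix_inv A *v u) \<bullet> v = u \<bullet> (matrix_inv A *v v)" for u v
    using pos_def_sym[OF assms, of "matrix_inv A *v u" "matrix_inv A *v v"]
      pos_def_inv_cancel[OF assms] by simp
  then have "u \<bullet> (transpose (matrix_inv A) *v v) = u \<bullet> (matrix_inv A *v v)" for u v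
    by (metis dot_lmul_matrix transpose_transpose vector_transpose_matrix)
  then show "transpose (matrix_inv A) = matrix_inv A"
    by (metis matrix_eq vector_eq_ldot)
next
  fix v :: "real^'n" assume "v \<noteq> 0"
  then have "matrix_inv A *v v \<noteq> 0"
    using pos_def_inv_cancel[OF assms, of v] by auto
  then show "0 < v \<bullet> (matrix_inv A *v v)"
    using pos_def_pos[OF assms, of "matrix_inv A *v v"] pos_def_inv_cancel[OF assms, of v]
    by (simp add: inner_commute)
qed

lemma pos_def_congruence:
  fixes A :: "real^'n^'n"
  assumes A: "pos_def A" and E: "det E \<noteq> 0"
  shows "pos_def (E ** A ** transpose E)"
  unfolding pos_def_def
proof (intro conjI allI impI)
  show "transpose (E ** A ** transpose E) = E ** A ** transpose E"
    using A by (simp add: matrix_transpose_mul matrix_mul_assoc pos_def_def)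
  fix v :: "real^'n" assume v: "v \<noteq> 0"
  have "invertible (transpose E)"
    using E by (simp add: invertible_det_nz)
  then have "transpose E *v v \<noteq> 0"
    using v unfolding invertible_def
    by (metis matrix_vector_mul_assoc matrix_vector_mul_lid matrix_vector_mult_0_right)
  then have "0 < (transpose E *v v) \<bullet> (A *v (transpose E *v v))"
    using A pos_def_pos by blast
  then show "0 < v \<bullet> (E ** A ** transpose E *v v)"
    by (simp add: dot_lmul_matrix flip: matrix_vector_mul_assoc)
qed

lemma pos_def_lower_bound:
  fixes A :: "real^'n^'n"
  assumes "pos_def A"
  shows "\<exists>w>0. \<forall>v. w * (norm v)\<^sup>2 \<le> v \<bullet> (A *v v)"
proof -
  let ?S = "sphere (0::real^'n) 1"
  have "compact ?S" "?S \<noteq> {}"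
    by auto
  moreover have "continuous_on ?S (\<lambda>v. v \<bullet> (A *v v))"
    by (intro continuous_intros)
  ultimately obtain u where u: "u \<in> ?S" "\<forall>v\<in>?S. u \<bullet> (A *v u) \<le> v \<bullet> (A *v v)"
    using continuous_attains_inf by blast
  show ?thesis
  proof (intro exI conjI allI)
    show "0 < u \<bullet> (A *v u)"
      using u assms by (intro pos_def_pos) auto
    fix v :: "real^'n"
    show "u \<bullet> (A *v u) * (norm v)\<^sup>2 \<le> v \<bullet> (A *v v)"
    proof (cases "v = 0")
      case False
      have "u \<bullet> (A *v u) \<le> (v /\<^sub>R norm v) \<bullet> (A *v (v /\<^sub>R norm v))"
        using False by (intro u(2)[rule_format]) auto
      also have "\<dots> = v \<bullet> (A *v v) / (norm v)\<^sup>2"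
        by (simp add: matrix_vector_mult_scaleR power2_eq_square divide_simps)
      finally show ?thesis
        using False by (simp add: field_simps)
    qed auto
  qed
qed

lemma matrix_vec_norm_bound: "\<exists>L>0. \<forall>v. norm (A *v v) \<le> L * norm (v :: real^'n)"
  by (metis bounded_linear.pos_bounded matrix_vector_mul_bounded_linear mult.commute)

text \<open>For \<open>v = A\<^sup>-\<^sup>1 u\<close> the lower bound gives \<open>m \<parallel>v\<parallel>\<^sup>2 \<le> v\<^sup>T u\<close>, hence \<open>m \<parallel>v\<parallel> \<le> \<parallel>u\<parallel>\<close>.\<close>

lemma pos_def_inv_upper_bound:
  assumes A: "pos_def A" and m: "0 < m" and low: "\<And>v. m * (norm v)\<^sup>2 \<le> v \<bullet> (A *v v)"
  shows "u \<bullet> (matrix_inv A *v u) \<le> (norm u)\<^sup>2 / m"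
proof -
  define v where "v = matrix_inv A *v u"
  have Av: "A *v v = u"
    by (simp add: v_def pos_def_inv_cancel[OF A])
  have "m * (norm v)\<^sup>2 \<le> norm v * norm u"
    using low[of v] norm_cauchy_schwarz[of v u] by (simp add: Av)
  then have "m * norm v \<le> norm u"
    by (cases "v = 0") (auto simp: power2_eq_square)
  then have "norm v \<le> norm u / m"
    using m by (simp add: field_simps)
  then have "norm u * norm v \<le> norm u * (norm u / m)"
    by (intro mult_left_mono) auto
  moreover have "u \<bullet> v \<le> norm u * norm v"
    by (rule norm_cauchy_schwarz)
  ultimately show ?thesis
    by (simp add: v_def power2_eq_square)
qed

text \<open>Cauchy--Schwarz for the pair of dual norms given by \<open>A\<close> and its inverse: minimize the dual norm
  of \<open>u - t A v\<close> over \<open>t\<close>.\<close>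

lemma pos_def_dual_Cauchy_Schwarz:
  assumes A: "pos_def A"
  shows "(u \<bullet> v)\<^sup>2 \<le> (u \<bullet> (matrix_inv A *v u)) * (v \<bullet> (A *v v))"
proof (cases "v = 0")
  case False
  let ?W = "matrix_inv A"
  define a where "a = v \<bullet> (A *v v)"
  define t where "t = (u \<bullet> v) / a"
  have a: "0 < a"
    using False A by (simp add: a_def pos_def_pos)
  have W: "pos_def ?W"
    by (rule pos_def_inverse[OF A])
  have "0 \<le> (u - t *\<^sub>R (A *v v)) \<bullet> (?W *v (u - t *\<^sub>R (A *v v)))"
    by (rule pos_def_nonneg[OF W])
  also have "\<dots> = u \<bullet> (?W *v u) - 2 * t * (u \<bullet> v) + t\<^sup>2 * a"
    using pos_def_sym[OF W, of "A *v v" u]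
    by (simp add: matrix_vector_mult_diff_distrib matrix_vector_mult_scaleR inner_diff_left inner_diff_right
        pos_def_inv_cancel[OF A] a_def power2_eq_square algebra_simps inner_commute)
  also have "\<dots> = u \<bullet> (?W *v u) - (u \<bullet> v)\<^sup>2 / a"
    using a by (simp add: t_def power2_eq_square field_simps)
  finally show ?thesis
    using a by (simp add: a_def field_simps)
qed auto

text \<open>Symmetric elimination of one row after another writes \<open>B\<close> as a sum of dyads
  \<open>v v\<^sup>T\<close>, and \<open>tr (A v v\<^sup>T) = v\<^sup>T A v\<close> is nonnegative. The induction runs over
  a set containing the indices of the rows that are still nonzero.\<close>

lemma trace_mult_nonneg:
  fixes A B :: "real^'n^'n"
  assumes A: "\<And>v. 0 \<le> v \<bullet> (A *v v)"
    and sym: "transpose B = B" and B: "\<And>v. 0 \<le> v \<bullet> (B *v v)"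
  shows "0 \<le> trace (A ** B)"
proof -
  have "0 \<le> trace (A ** B)"
    if "finite S" "transpose B = B" "\<And>v. 0 \<le> v \<bullet> (B *v v)" "\<And>i. i \<notin> S \<Longrightarrow> B $ i = 0"
    for S and B :: "real^'n^'n"
    using that
  proof (induction S arbitrary: B rule: finite_induct)
    case empty
    then have "B = 0"
      by (simp add: vec_eq_iff)
    then show ?case
      by (simp add: trace_def)
  next
    case (insert i S)
    let ?e = "axis i 1 :: real^'n"
    define b where "b = B *v ?e"
    define \<beta> where "\<beta> = B $ i $ i"
    have sym: "B $ k $ l = B $ l $ k" for k l
      using insert.prems(1) by (rule symmetric_nth)
    have b_nth: "b $ k = B $ k $ i" for k
      by (simp add: b_def matrix_vector_mult_basis column_def)
    have eb: "?e \<bullet> b = \<beta>"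
      by (simp add: inner_axis' b_nth \<beta>_def)
    have quad: "(v - t *\<^sub>R ?e) \<bullet> (B *v (v - t *\<^sub>R ?e)) = v \<bullet> (B *v v) - 2 * t * (b \<bullet> v) + t\<^sup>2 * \<beta>" for v t
      using inner_matrix_vec_commute[OF insert.prems(1), of ?e v] eb
      by (simp add: matrix_vector_mult_diff_distrib matrix_vector_mult_scaleR inner_diff_left inner_diff_right
          power2_eq_square algebra_simps inner_commute flip: b_def)
    have \<beta>0: "0 \<le> \<beta>"
      using insert.prems(2)[of ?e] eb by (simp add: b_def)
    show ?case
    proof (cases "\<beta> = 0")
      case True
      \<comment> \<open>a vanishing diagonal entry forces the whole row to vanish\<close>
      have "b \<bullet> b = 0"
      proof (rule ccontr)
        assume nz: "b \<bullet> b \<noteq> 0"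
        \<comment> \<open>with \<open>\<beta> = 0\<close> the quadratic form is affine in \<open>t\<close>; at this \<open>t\<close> its value is \<open>- 1\<close>\<close>
        define t where "t = (b \<bullet> (B *v b) + 1) / (2 * (b \<bullet> b))"
        have "0 \<le> b \<bullet> (B *v b) - 2 * t * (b \<bullet> b)"
          using quad[of b t] insert.prems(2)[of "b - t *\<^sub>R ?e"] True by simp
        also have "\<dots> = - 1"
          using nz by (simp add: t_def field_simps)
        finally show False
          by simp
      qed
      then have "B $ i = 0"
        using b_nth sym by (simp add: vec_eq_iff)
      then have "B $ k = 0" if "k \<notin> S" for k
        using that insert.prems(3)[of k] by auto
      then show ?thesis
        using insert.prems(1,2) by (rule insert.IH[rotated 2])
    next
      case False
      define C where "C = B - (1 / \<beta>) *\<^sub>R outer b b"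
      have C_nth: "C $ k $ l = B $ k $ l - B $ k $ i * B $ l $ i / \<beta>" for k l
        by (simp add: C_def outer_def b_nth)
      have "0 \<le> trace (A ** C)"
      proof (rule insert.IH)
        show "transpose C = C"
          using sym by (simp add: vec_eq_iff transpose_def C_nth mult.commute)
        show "0 \<le> v \<bullet> (C *v v)" for v
        proof -
          have "0 \<le> v \<bullet> (B *v v) - (b \<bullet> v)\<^sup>2 / \<beta>"
            using insert.prems(2)[of "v - ((b \<bullet> v) / \<beta>) *\<^sub>R ?e"] quad[of v "(b \<bullet> v) / \<beta>"] False
            by (simp add: power2_eq_square)
          then show ?thesis
            by (simp add: C_def matrix_vector_mult_diff_rdistrib inner_diff_right power2_eq_square
                inner_commute flip: scaleR_matrix_vector_assoc)
        qed
        show "C $ k = 0" if "k \<notin> S" for k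
        proof (cases "k = i")
          case True
          have "C $ i $ l = 0" for l
            using False sym[of i l] by (simp add: C_nth \<beta>_def)
          then show ?thesis
            by (simp add: True vec_eq_iff)
        next
          case False
          then have "B $ k = 0"
            using that insert.prems(3) by auto
          then show ?thesis
            by (simp add: vec_eq_iff C_nth)
        qed
      qed
      moreover have "A ** B = A ** C + (1 / \<beta>) *\<^sub>R outer (A *v b) b"
      proof -
        have B: "C + (1 / \<beta>) *\<^sub>R outer b b = B"
          by (simp add: C_def)
        have "A ** (C + (1 / \<beta>) *\<^sub>R outer b b) = A ** C + (1 / \<beta>) *\<^sub>R outer (A *v b) b"
          by (simp add: matrix_add_ldistrib matrix_mult_outer matrix_mult_scaleR)
        then show ?thesis
          unfolding B .
      qed
      moreover have "0 \<le> (1 / \<beta>) * ((A *v b) \<bullet> b)"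
        using A[of b] \<beta>0 by (simp add: inner_commute)
      ultimately show ?thesis
        by (simp add: trace_add trace_scaleR)
    qed
  qed
  from this[of UNIV B] sym B show ?thesis
    by auto
qed

text \<open>The Leibniz formula bounds the determinant by \<open>n! t\<^sup>n\<close>, where the trace \<open>t\<close>
  dominates every entry.\<close>

lemma pos_def_det_le_trace:
  fixes B :: "real^'n^'n"
  assumes B: "pos_def B"
  shows "0 < trace B" "\<bar>det B\<bar> \<le> fact CARD('n) * trace B ^ CARD('n)"
proof -
  have diag: "0 < B $ i $ i" for i
    using pos_def_pos[OF B, of "axis i 1"]
    by (simp add: inner_axis' matrix_vector_mult_basis column_def axis_eq_0_iff)
  show "0 < trace B"
    unfolding trace_def using diag by (intro sum_pos) auto
  have diag_le: "B $ i $ i \<le> trace B" for i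
    unfolding trace_def using diag by (intro member_le_sum) (auto intro: less_imp_le)
  have entry: "\<bar>B $ i $ j\<bar> \<le> trace B" for i j
  proof -
    have sym: "B $ j $ i = B $ i $ j"
      using B by (intro symmetric_nth) (simp add: pos_def_def)
    have "(axis i 1 + c *\<^sub>R axis j 1) \<bullet> (B *v (axis i 1 + c *\<^sub>R axis j 1))
        = B $ i $ i + 2 * c * B $ i $ j + c\<^sup>2 * B $ j $ j" for c
      by (simp add: matrix_vector_right_distrib matrix_vector_mult_scaleR matrix_vector_mult_basis column_def
          inner_add_left inner_add_right inner_axis' sym power2_eq_square algebra_simps)
    then have "0 \<le> B $ i $ i + 2 * c * B $ i $ j + c\<^sup>2 * B $ j $ j" for c
      by (metis pos_def_nonneg[OF B])
    from this[of 1] this[of "-1"] diag_le[of i] diag_le[of j] show ?thesis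
      by simp
  qed
  have "\<bar>det B\<bar> \<le> (\<Sum>p\<in>{p. p permutes (UNIV::'n set)}. \<bar>of_int (sign p) * (\<Prod>i\<in>UNIV. B $ i $ p i)\<bar>)"
    unfolding det_def by (rule sum_abs)
  also have "\<dots> \<le> (\<Sum>p\<in>{p. p permutes (UNIV::'n set)}. trace B ^ CARD('n))"
  proof (rule sum_mono)
    fix p :: "'n \<Rightarrow> 'n"
    have "\<bar>of_int (sign p) * (\<Prod>i\<in>UNIV. B $ i $ p i)\<bar> = (\<Prod>i\<in>UNIV. \<bar>B $ i $ p i\<bar>)"
      by (simp add: abs_mult sign_def abs_prod)
    also have "\<dots> \<le> (\<Prod>i\<in>(UNIV::'n set). trace B)"
      by (intro prod_mono) (simp add: entry)
    finally show "\<bar>of_int (sign p) * (\<Prod>i\<in>UNIV. B $ i $ p i)\<bar> \<le> trace B ^ CARD('n)"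
      by simp
  qed
  also have "\<dots> = fact CARD('n) * trace B ^ CARD('n)"
    by (simp add: card_permutations)
  finally show "\<bar>det B\<bar> \<le> fact CARD('n) * trace B ^ CARD('n)" .
qed

text \<open>Conjugation by an orthogonal matrix moves \<open>v\<close> onto a coordinate axis; then only one
  column differs from the identity.\<close>

lemma det_identity_plus_outer:
  fixes u v :: "real^'n"
  shows "det (mat 1 + outer u v) = 1 + u \<bullet> v"
proof -
  \<comment> \<open>an arbitrary coordinate\<close>
  define i :: 'n where "i = undefined"
  have "norm v = norm (norm v *\<^sub>R axis i (1::real))"
    by simp
  from orthogonal_transformation_exists[OF this]
  obtain f where f: "orthogonal_transformation f" "f v = norm v *\<^sub>R axis i (1::real)"
    by metis
  define Q where "Q = matrix f"
  have Q: "orthogonal_matrix Q" and Qf: "Q *v w = f w" for w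
    using f by (auto simp: Q_def orthogonal_transformation_matrix linear_matrix_vector_mul_eq matrix_works)
  have QQ: "Q ** transpose Q = mat 1"
    using Q by (simp add: orthogonal_matrix_def)
  have detQ: "det Q * det Q = 1"
    using det_orthogonal_matrix[OF Q] by auto
  define y where "y = axis i 1 + norm v *\<^sub>R (Q *v u)"
  have "transpose (Q ** (mat 1 + outer u v) ** transpose Q)
      = (\<chi> k. if k = i then \<Sum>l\<in>UNIV. y $ l *s row l (mat 1) else row k (mat 1))"
  proof -
    have "Q ** (mat 1 + outer u v) ** transpose Q = mat 1 + outer (Q *v u) (Q *v v)"
      using QQ by (simp add: matrix_add_ldistrib matrix_add_rdistrib matrix_mult_outer outer_mult_matrix)
    then show ?thesis
      unfolding Qf[of v] f(2)
      by (auto simp: vec_eq_iff transpose_def outer_def y_def mat_def axis_def row_def if_distrib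
          sum.distrib cong: if_cong)
  qed
  then have "det (transpose (Q ** (mat 1 + outer u v) ** transpose Q)) = y $ i * det (mat 1 :: real^'n^'n)"
    by (simp only: cramer_lemma_transpose)
  then have "det (mat 1 + outer u v) * (det Q * det Q) = y $ i"
    by (simp add: det_mul mult_ac)
  also have "y $ i = 1 + (Q *v u) \<bullet> (Q *v v)"
    unfolding Qf[of v] f(2) by (simp add: y_def inner_axis)
  also have "(Q *v u) \<bullet> (Q *v v) = u \<bullet> v"
    using f(1) by (simp add: Qf orthogonal_transformation_def)
  finally show ?thesis
    by (simp add: detQ)
qed

section \<open>The BFGS update and its potential\<close>

text \<open>The update is a congruence \<open>E B E\<^sup>T\<close> with \<open>E = 1 + c z s\<^sup>T\<close>, where
  \<open>z = g - \<tau> B s\<close>, \<open>\<tau>\<^sup>2 = g\<^sup>T s / s\<^sup>T B s\<close> and \<open>c = 1 / (\<tau> s\<^sup>T B s)\<close>; this is the product form of the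
  BFGS formula. As \<open>det E = \<tau>\<close>, both preservation of positive definiteness and the determinant of
  the update can be read off.\<close>

lemma bfgs_update_congruence:
  assumes B: "pos_def B" and s: "s \<noteq> 0" and gs: "0 < g \<bullet> s"
  obtains E where "bfgs_update B s g = E ** B ** transpose E" "(det E)\<^sup>2 = (g \<bullet> s) / (s \<bullet> (B *v s))"
    "0 < det E"
proof
  define b where "b = B *v s"
  define a where "a = s \<bullet> b"
  define \<tau> where "\<tau> = sqrt ((g \<bullet> s) / a)"
  define z where "z = g - \<tau> *\<^sub>R b"
  define c where "c = 1 / (\<tau> * a)"
  define E where "E = mat 1 + outer (c *\<^sub>R z) s"
  have a: "0 < a"
    using B s by (simp add: a_def b_def pos_def_pos)
  have \<tau>: "0 < \<tau>" and \<tau>2: "\<tau>\<^sup>2 = (g \<bullet> s) / a"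
    using a gs by (auto simp: \<tau>_def)
  have gs_eq: "g \<bullet> s = \<tau>\<^sup>2 * a"
    using a \<tau>2 by simp
  have "det E = 1 + c * (g \<bullet> s - \<tau> * a)"
    by (simp add: E_def det_identity_plus_outer z_def inner_diff_left inner_diff_right a_def inner_commute)
  also have "\<dots> = \<tau>"
    unfolding gs_eq using a \<tau> by (simp add: c_def power2_eq_square field_simps)
  finally have det: "det E = \<tau>" .
  show "(det E)\<^sup>2 = (g \<bullet> s) / (s \<bullet> (B *v s))" "0 < det E"
    using det \<tau> \<tau>2 by (auto simp: a_def b_def)
  have sB: "s \<bullet> (B *v v) = b \<bullet> v" for v
    using pos_def_sym[OF B, of s v] by (simp add: b_def)
  have tE: "transpose E *v v = v + (c * (z \<bullet> v)) *\<^sub>R s" for v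
  proof -
    have "transpose E = mat 1 + outer s (c *\<^sub>R z)"
      by (simp add: E_def transpose_def outer_def mat_def vec_eq_iff mult.commute eq_commute)
    then show ?thesis
      by (simp add: matrix_vector_mult_add_rdistrib)
  qed
  have "(E ** B ** transpose E) *v v = bfgs_update B s g *v v" for v
  proof -
    define t where "t = c * (z \<bullet> v)"
    have "(E ** B ** transpose E) *v v = E *v (B *v (transpose E *v v))"
      by (simp flip: matrix_vector_mul_assoc)
    also have "\<dots> = E *v (B *v v + t *\<^sub>R b)"
      by (simp only: tE t_def matrix_vector_right_distrib matrix_vector_mult_scaleR b_def)
    also have "\<dots> = B *v v + t *\<^sub>R b + (c * (b \<bullet> v + t * a)) *\<^sub>R z"
      by (simp add: E_def matrix_vector_mult_add_rdistrib inner_add_right sB a_def mult.commute)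
    also have "\<dots> = B *v v + (t - \<tau> * (c * (b \<bullet> v + t * a))) *\<^sub>R b + (c * (b \<bullet> v + t * a)) *\<^sub>R g"
      by (simp add: z_def algebra_simps)
    also have "c * (b \<bullet> v + t * a) = (g \<bullet> v) / (g \<bullet> s)"
      unfolding gs_eq using a \<tau>
      by (simp add: t_def c_def z_def inner_diff_left power2_eq_square field_simps)
    also have "t - \<tau> * ((g \<bullet> v) / (g \<bullet> s)) = - ((b \<bullet> v) / a)"
      unfolding gs_eq using a \<tau>
      by (simp add: t_def c_def z_def inner_diff_left power2_eq_square field_simps)
    also have "B *v v + (- ((b \<bullet> v) / a)) *\<^sub>R b + ((g \<bullet> v) / (g \<bullet> s)) *\<^sub>R g = bfgs_update B s g *v v"
      by (simp add: bfgs_update_def matrix_vector_mult_add_rdistrib matrix_vector_mult_diff_rdistrib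
          matrix_vector_mult_scaleR sB a_def flip: scaleR_matrix_vector_assoc matrix_vector_mul_assoc b_def)
    finally show ?thesis .
  qed
  then show "bfgs_update B s g = E ** B ** transpose E"
    by (simp add: matrix_eq)
qed

lemma pos_def_bfgs_update:
  assumes "pos_def B" "s \<noteq> 0" "0 < g \<bullet> s"
  shows "pos_def (bfgs_update B s g)"
proof -
  obtain E where "bfgs_update B s g = E ** B ** transpose E" "0 < det E"
    using bfgs_update_congruence[OF assms] by metis
  then show ?thesis
    using pos_def_congruence[OF assms(1), of E] by simp
qed

lemma det_bfgs_update:
  assumes "pos_def B" "s \<noteq> 0" "0 < g \<bullet> s"
  shows "det (bfgs_update B s g) = det B * ((g \<bullet> s) / (s \<bullet> (B *v s)))"
proof -
  obtain E where "bfgs_update B s g = E ** B ** transpose E" "(det E)\<^sup>2 = (g \<bullet> s) / (s \<bullet> (B *v s))"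
    using bfgs_update_congruence[OF assms] by metis
  then show ?thesis
    by (simp add: det_mul power2_eq_square mult_ac)
qed

lemma trace_mult_bfgs_update:
  assumes "pos_def B"
  shows "trace (W ** bfgs_update B s g) = trace (W ** B)
    - ((B *v s) \<bullet> (W *v (B *v s))) / (s \<bullet> (B *v s)) + (g \<bullet> (W *v g)) / (g \<bullet> s)"
proof -
  have "transpose B = B"
    using assms by (simp add: pos_def_def)
  then have "W ** bfgs_update B s g = W ** B + (- 1 / (s \<bullet> (B *v s))) *\<^sub>R outer (W *v (B *v s)) (B *v s)
      + (1 / (g \<bullet> s)) *\<^sub>R outer (W *v g) g"
    by (simp add: bfgs_update_def matrix_mult_outer outer_mult_matrix matrix_eq matrix_vector_mult_diff_rdistrib
        matrix_vector_mult_add_rdistrib matrix_vector_right_distrib matrix_vector_mult_diff_distrib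
        matrix_vector_mult_scaleR flip: matrix_vector_mul_assoc scaleR_matrix_vector_assoc)
  then show ?thesis
    by (simp add: trace_add trace_sub trace_scaleR inner_commute)
qed

text \<open>For \<open>G = 1\<close> and \<open>det B > 0\<close> this is the function of Byrd and Nocedal. A general
  weight replaces the usual conjugation of \<open>B\<close> by \<open>G\<^sup>-\<^sup>1\<^sup>/\<^sup>2\<close>, so that no square root of a matrix is
  needed; the absolute value makes a nonzero determinant sufficient.\<close>

definition bfgs_potential :: "real^'n^'n \<Rightarrow> real^'n^'n \<Rightarrow> real" where
  "bfgs_potential G B = trace (matrix_inv G ** B) - ln \<bar>det B\<bar>"

definition scaling_ratio :: "real^'n^'n \<Rightarrow> real^'n^'n \<Rightarrow> real^'n \<Rightarrow> real" where
  "scaling_ratio G B s = ((B *v s) \<bullet> (matrix_inv G *v (B *v s))) / (s \<bullet> (B *v s))"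

definition curvature_ratio :: "real^'n^'n \<Rightarrow> real^'n^'n \<Rightarrow> real^'n \<Rightarrow> real" where
  "curvature_ratio G B s = (s \<bullet> (B *v s)) / (s \<bullet> (G *v s))"

definition curvature_defect :: "real^'n^'n \<Rightarrow> real^'n^'n \<Rightarrow> real^'n \<Rightarrow> real" where
  "curvature_defect G B s = scaling_ratio G B s - 1 - ln (curvature_ratio G B s)"

definition secant_defect :: "real^'n^'n \<Rightarrow> real^'n \<Rightarrow> real^'n \<Rightarrow> real" where
  "secant_defect G s g =
    (g \<bullet> (matrix_inv G *v g)) / (g \<bullet> s) - 1 - ln ((g \<bullet> s) / (s \<bullet> (G *v s)))"

text \<open>Both defects arise from splitting the factor \<open>g\<^sup>T s / s\<^sup>T B s\<close> of the determinant at
  \<open>s\<^sup>T G s\<close>; each of them vanishes when its matrix or vector agrees with \<open>G\<close> along \<open>s\<close>.\<close>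

lemma bfgs_potential_update:
  assumes B: "pos_def B" and G: "pos_def G" and s: "s \<noteq> 0" and gs: "0 < g \<bullet> s"
  shows "bfgs_potential G (bfgs_update B s g)
    = bfgs_potential G B - curvature_defect G B s + secant_defect G s g"
proof -
  have pos: "0 < s \<bullet> (B *v s)" "0 < s \<bullet> (G *v s)" "det B \<noteq> 0"
    using B G s by (auto simp: pos_def_pos pos_def_det_nonzero)
  have "ln \<bar>det (bfgs_update B s g)\<bar> = ln \<bar>det B\<bar> + ln ((g \<bullet> s) / (s \<bullet> (B *v s)))"
    using pos gs by (simp add: det_bfgs_update[OF B s gs] abs_mult ln_mult ln_div)
  also have "ln ((g \<bullet> s) / (s \<bullet> (B *v s)))
      = ln ((g \<bullet> s) / (s \<bullet> (G *v s))) - ln (curvature_ratio G B s)"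
    using pos gs by (simp add: curvature_ratio_def ln_div)
  finally show ?thesis
    by (simp add: bfgs_potential_def trace_mult_bfgs_update[OF B] curvature_defect_def secant_defect_def
        scaling_ratio_def)
qed

text \<open>The trace term dominates a multiple of \<open>tr B\<close>, while \<open>ln \<bar>det B\<bar>\<close> grows at most like
  \<open>n ln (tr B)\<close>.\<close>

lemma bfgs_potential_bounded_below:
  fixes G :: "real^'n^'n"
  assumes G: "pos_def G"
  shows "\<exists>c. \<forall>B. pos_def B \<longrightarrow> c \<le> bfgs_potential G B"
proof -
  let ?W = "matrix_inv G"
  let ?n = "real CARD('n)"
  obtain w where w: "0 < w" "\<And>v. w * (norm v)\<^sup>2 \<le> v \<bullet> (?W *v v)"
    using pos_def_lower_bound[OF pos_def_inverse[OF G]] by blast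
  have n: "0 < ?n"
    by simp
  show ?thesis
  proof (intro exI allI impI)
    fix B :: "real^'n^'n" assume B: "pos_def B"
    let ?t = "trace B"
    note t = pos_def_det_le_trace[OF B]
    have "0 \<le> trace ((?W - w *\<^sub>R mat 1) ** B)"
    proof (rule trace_mult_nonneg)
      fix v :: "real^'n"
      show "0 \<le> v \<bullet> ((?W - w *\<^sub>R mat 1) *v v)"
        using w(2)[of v]
        by (simp add: matrix_vector_mult_diff_rdistrib inner_diff_right power2_norm_eq_inner
            flip: scaleR_matrix_vector_assoc)
      show "0 \<le> v \<bullet> (B *v v)"
        by (rule pos_def_nonneg[OF B])
    qed (use B in \<open>simp add: pos_def_def\<close>)
    also have "(?W - w *\<^sub>R mat 1) ** B = ?W ** B + (- w) *\<^sub>R B"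
      by (simp add: matrix_eq matrix_vector_mult_diff_rdistrib matrix_vector_mult_add_rdistrib
          flip: scaleR_matrix_vector_assoc matrix_vector_mul_assoc)
    finally have 1: "w * ?t \<le> trace (?W ** B)"
      by (simp add: trace_add trace_sub trace_scaleR)
    have "ln \<bar>det B\<bar> \<le> ln (fact CARD('n) * ?t ^ CARD('n))"
      using t pos_def_det_nonzero[OF B] by (subst ln_le_cancel_iff) auto
    also have "\<dots> = ln (fact CARD('n)) + ?n * ln ?t"
      using t(1) by (simp add: ln_mult ln_realpow)
    finally have 2: "ln \<bar>det B\<bar> \<le> ln (fact CARD('n)) + ?n * ln ?t" .
    have "ln ?t = ln (w * ?t / ?n) - ln (w / ?n)"
      using t(1) w(1) n by (simp add: ln_div ln_mult)
    also have "ln (w * ?t / ?n) \<le> w * ?t / ?n - 1"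
      using t(1) w(1) n by (intro ln_le_minus_one) auto
    finally have "?n * ln ?t \<le> ?n * (w * ?t / ?n - 1 - ln (w / ?n))"
      by (intro mult_left_mono) auto
    also have "\<dots> = w * ?t - ?n - ?n * ln (w / ?n)"
      using n by (simp add: right_diff_distrib)
    finally show "?n + ?n * ln (w / ?n) - ln (fact CARD('n)) \<le> bfgs_potential G B"
      using 1 2 by (simp add: bfgs_potential_def)
  qed
qed

lemma curvature_ratio_pos:
  "pos_def B \<Longrightarrow> pos_def G \<Longrightarrow> s \<noteq> 0 \<Longrightarrow> 0 < curvature_ratio G B s"
  by (simp add: curvature_ratio_def pos_def_pos)

lemma curvature_ratio_le_scaling_ratio:
  assumes B: "pos_def B" and G: "pos_def G" and s: "s \<noteq> 0"
  shows "curvature_ratio G B s \<le> scaling_ratio G B s"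
proof -
  have pos: "0 < s \<bullet> (B *v s)" "0 < s \<bullet> (G *v s)"
    using B G s by (auto simp: pos_def_pos)
  have "(s \<bullet> (B *v s))\<^sup>2 \<le> ((B *v s) \<bullet> (matrix_inv G *v (B *v s))) * (s \<bullet> (G *v s))"
    using pos_def_dual_Cauchy_Schwarz[OF G, of "B *v s" s] by (simp add: inner_commute)
  then show ?thesis
    using pos by (simp add: curvature_ratio_def scaling_ratio_def field_simps power2_eq_square)
qed

text \<open>The defect is the sum of \<open>p - 1 - ln p \<ge> 0\<close> and \<open>ln (p / q) \<ge> 0\<close>, where \<open>q \<le> p\<close> are the
  curvature and the scaling ratio. It therefore controls how far both are from \<open>1\<close>.\<close>

lemma curvature_defect_bounds:
  assumes B: "pos_def B" and G: "pos_def G" and s: "s \<noteq> 0"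
  defines "p \<equiv> scaling_ratio G B s" and "q \<equiv> curvature_ratio G B s"
  shows "0 \<le> curvature_defect G B s"
    and "p - 1 - ln p \<le> curvature_defect G B s"
    and "ln p - ln q \<le> curvature_defect G B s"
proof -
  have q: "0 < q" and qp: "q \<le> p"
    unfolding p_def q_def
    using curvature_ratio_pos[OF B G s] curvature_ratio_le_scaling_ratio[OF B G s] .
  have "ln p \<le> p - 1"
    using q qp by (intro ln_le_minus_one) auto
  moreover have "ln q \<le> ln p"
    using q qp by simp
  ultimately show "0 \<le> curvature_defect G B s" "p - 1 - ln p \<le> curvature_defect G B s"
      "ln p - ln q \<le> curvature_defect G B s"
    by (auto simp: curvature_defect_def simp flip: p_def q_def)
qed

text \<open>A bounded defect bounds \<open>p\<close> from above and \<open>q\<close> from below, and \<open>p q\<close> is the squared dual norm of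
  \<open>B s\<close> relative to \<open>s\<^sup>T G s\<close>.\<close>

lemma norm_bounds_of_curvature_defect:
  assumes G: "pos_def G"
  shows "\<exists>\<beta>>0. \<exists>\<Lambda>>0. \<forall>B s. pos_def B \<longrightarrow> s \<noteq> 0 \<longrightarrow> curvature_defect G B s \<le> T \<longrightarrow>
    \<beta> * (norm s)\<^sup>2 \<le> s \<bullet> (B *v s) \<and> norm (B *v s) \<le> \<Lambda> * norm s"
proof -
  obtain m where m: "0 < m" "\<And>v. m * (norm v)\<^sup>2 \<le> v \<bullet> (G *v v)"
    using pos_def_lower_bound[OF G] by blast
  obtain w where w: "0 < w" "\<And>v. w * (norm v)\<^sup>2 \<le> v \<bullet> (matrix_inv G *v v)"
    using pos_def_lower_bound[OF pos_def_inverse[OF G]] by blast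
  obtain L where L: "0 < L" "\<And>v. norm (G *v v) \<le> L * norm v"
    using matrix_vec_norm_bound by blast
  define P where "P = 2 * \<bar>T\<bar> + 2"
  define \<Lambda> where "\<Lambda> = P * sqrt (L / w)"
  have "exp (- 2 * \<bar>T\<bar> - 1) * m > 0" "\<Lambda> > 0"
    using m L w by (auto simp: \<Lambda>_def P_def)
  moreover have "exp (- 2 * \<bar>T\<bar> - 1) * m * (norm s)\<^sup>2 \<le> s \<bullet> (B *v s) \<and> norm (B *v s) \<le> \<Lambda> * norm s"
    if B: "pos_def B" and s: "s \<noteq> 0" and T: "curvature_defect G B s \<le> T" for B s
  proof -
    define p where "p = scaling_ratio G B s"
    define q where "q = curvature_ratio G B s"
    note defect = curvature_defect_bounds[OF B G s, folded p_def q_def]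
    have pos: "0 < s \<bullet> (B *v s)" "0 < s \<bullet> (G *v s)"
      using B G s by (auto simp: pos_def_pos)
    have q: "0 < q" and qp: "q \<le> p"
      unfolding p_def q_def
      using curvature_ratio_pos[OF B G s] curvature_ratio_le_scaling_ratio[OF B G s] .
    have "ln p = ln (p / 2) + ln 2"
      using q qp by (simp add: ln_div)
    moreover have "ln (p / 2) \<le> p / 2 - 1" "ln (2::real) \<le> 1"
      using q qp ln_le_minus_one[of "p / 2"] ln_le_minus_one[of 2] by auto
    ultimately have P: "p \<le> P"
      using defect(2) T by (simp add: P_def)
    have "ln p \<ge> - 1 - \<bar>T\<bar>"
      using defect(2) T q qp by linarith
    then have "- 2 * \<bar>T\<bar> - 1 \<le> ln q"
      using defect(3) T by linarith
    then have "exp (- 2 * \<bar>T\<bar> - 1) \<le> q"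
      using q by (simp add: ln_ge_iff)
    then have "exp (- 2 * \<bar>T\<bar> - 1) * (m * (norm s)\<^sup>2) \<le> q * (s \<bullet> (G *v s))"
      using m q by (intro mult_mono) auto
    also have "\<dots> = s \<bullet> (B *v s)"
      using pos by (simp add: q_def curvature_ratio_def)
    finally have 1: "exp (- 2 * \<bar>T\<bar> - 1) * m * (norm s)\<^sup>2 \<le> s \<bullet> (B *v s)"
      by (simp add: mult.assoc)
    have "w * (norm (B *v s))\<^sup>2 \<le> p * (s \<bullet> (B *v s))"
      using w(2)[of "B *v s"] pos by (simp add: p_def scaling_ratio_def)
    also have "\<dots> = p * q * (s \<bullet> (G *v s))"
      using pos by (simp add: q_def curvature_ratio_def)
    also have "\<dots> \<le> P * P * (L * (norm s)\<^sup>2)"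
    proof (intro mult_mono)
      have "s \<bullet> (G *v s) \<le> norm s * norm (G *v s)"
        by (rule norm_cauchy_schwarz)
      also have "\<dots> \<le> norm s * (L * norm s)"
        by (intro mult_left_mono L) auto
      finally show "s \<bullet> (G *v s) \<le> L * (norm s)\<^sup>2"
        by (simp add: power2_eq_square mult_ac)
    qed (use P q qp pos in auto)
    finally have "(norm (B *v s))\<^sup>2 \<le> P * P * (L / w) * (norm s)\<^sup>2"
      using w by (simp add: field_simps)
    also have "\<dots> = (\<Lambda> * norm s)\<^sup>2"
      using L w by (simp add: \<Lambda>_def power_mult_distrib) (simp add: power2_eq_square)
    finally have "norm (B *v s) \<le> \<Lambda> * norm s"
      by (rule power2_le_imp_le) (use \<open>0 < \<Lambda>\<close> in simp)
    with 1 show ?thesis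
      by blast
  qed
  ultimately show ?thesis
    by blast
qed

text \<open>The logarithm of \<open>sqrt p\<close> is at most \<open>sqrt p - 1\<close>, hence \<open>(sqrt p - 1)\<^sup>2 \<le> p - 1 - ln p\<close>.\<close>

lemma tendsto_1_if_minus_ln_tendsto_0:
  fixes p :: "nat \<Rightarrow> real"
  assumes p: "\<And>k. 0 < p k" and lim: "(\<lambda>k. p k - 1 - ln (p k)) \<longlonglongrightarrow> 0"
  shows "p \<longlonglongrightarrow> 1"
proof -
  have le: "(sqrt (p k) - 1)\<^sup>2 \<le> p k - 1 - ln (p k)" for k
  proof -
    have "ln (p k) = 2 * ln (sqrt (p k))"
      using p[of k] by (simp add: ln_sqrt)
    also have "\<dots> \<le> 2 * (sqrt (p k) - 1)"
      using p[of k] ln_le_minus_one[of "sqrt (p k)"] by simp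
    finally show ?thesis
      using p[of k] by (simp add: power2_diff)
  qed
  have "(\<lambda>k. (sqrt (p k) - 1)\<^sup>2) \<longlonglongrightarrow> 0"
    by (rule tendsto_sandwich[OF _ _ tendsto_const lim]) (auto simp: le)
  then have "(\<lambda>k. sqrt (p k) - 1) \<longlonglongrightarrow> 0"
    using tendsto_real_sqrt by (fastforce simp: tendsto_rabs_zero_iff)
  then have "(\<lambda>k. sqrt (p k)) \<longlonglongrightarrow> 1"
    by (simp add: LIM_zero_iff)
  then have "(\<lambda>k. (sqrt (p k))\<^sup>2) \<longlonglongrightarrow> 1\<^sup>2"
    by (intro tendsto_intros)
  then show ?thesis
    using p by (simp add: less_imp_le)
qed

text \<open>In the norm induced by the inverse of \<open>G\<close>, the square of \<open>(B - G) s\<close> relative to \<open>s\<^sup>T G s\<close>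
  is \<open>p q - 2 q + 1\<close>, which vanishes as both ratios tend to \<open>1\<close>.\<close>

lemma Dennis_More_of_curvature_defect:
  fixes B :: "nat \<Rightarrow> real^'n^'n"
  assumes G: "pos_def G" and B: "\<And>k. pos_def (B k)" and s: "\<And>k. s k \<noteq> 0"
    and lim: "(\<lambda>k. curvature_defect G (B k) (s k)) \<longlonglongrightarrow> 0" and \<epsilon>: "0 < \<epsilon>"
  shows "\<forall>\<^sub>F k in sequentially. norm (B k *v s k - G *v s k) \<le> \<epsilon> * norm (s k)"
proof -
  let ?W = "matrix_inv G"
  define p where "p k = scaling_ratio G (B k) (s k)" for k
  define q where "q k = curvature_ratio G (B k) (s k)" for k
  obtain w where w: "0 < w" "\<And>v. w * (norm v)\<^sup>2 \<le> v \<bullet> (?W *v v)"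
    using pos_def_lower_bound[OF pos_def_inverse[OF G]] by blast
  obtain L where L: "0 < L" "\<And>v. norm (G *v v) \<le> L * norm v"
    using matrix_vec_norm_bound by blast
  have q: "0 < q k" and qp: "q k \<le> p k" for k
    unfolding p_def q_def
    using curvature_ratio_pos[OF B G s] curvature_ratio_le_scaling_ratio[OF B G s] .
  have defect: "p k - 1 - ln (p k) \<le> curvature_defect G (B k) (s k)"
      "ln (p k) - ln (q k) \<le> curvature_defect G (B k) (s k)" for k
    unfolding p_def q_def using curvature_defect_bounds[OF B G s] by blast+
  have p: "0 < p k" for k
    using q[of k] qp[of k] by linarith
  have "(\<lambda>k. p k - 1 - ln (p k)) \<longlonglongrightarrow> 0"
    by (rule tendsto_sandwich[OF _ _ tendsto_const lim])
      (use defect p in \<open>auto intro!: always_eventually ln_le_minus_one\<close>)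
  then have p1: "p \<longlonglongrightarrow> 1"
    using p by (intro tendsto_1_if_minus_ln_tendsto_0)
  have "(\<lambda>k. ln (p k) - ln (q k)) \<longlonglongrightarrow> 0"
    by (rule tendsto_sandwich[OF _ _ tendsto_const lim])
      (use defect p q qp in \<open>auto intro!: always_eventually\<close>)
  then have "(\<lambda>k. exp (ln (p k) - (ln (p k) - ln (q k)))) \<longlonglongrightarrow> exp (ln 1 - 0)"
    by (intro tendsto_intros p1) auto
  then have q1: "q \<longlonglongrightarrow> 1"
    using q by simp
  have "(\<lambda>k. p k * q k - 2 * q k + 1) \<longlonglongrightarrow> 1 * 1 - 2 * 1 + 1"
    by (intro tendsto_intros p1 q1)
  then have "\<forall>\<^sub>F k in sequentially. p k * q k - 2 * q k + 1 < \<epsilon>\<^sup>2 * w / L"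
    by (rule order_tendstoD) (use \<epsilon> w L in auto)
  then show ?thesis
  proof eventually_elim
    case (elim k)
    let ?b = "B k *v s k" and ?g = "G *v s k"
    have pos: "0 < s k \<bullet> ?b" "0 < s k \<bullet> ?g"
      using B G s by (auto simp: pos_def_pos)
    have "w * (norm (?b - ?g))\<^sup>2 \<le> (?b - ?g) \<bullet> (?W *v (?b - ?g))"
      by (rule w)
    also have "\<dots> = ?b \<bullet> (?W *v ?b) - 2 * (s k \<bullet> ?b) + s k \<bullet> ?g"
      using pos_def_sym[OF pos_def_inverse[OF G], of ?g ?b]
      by (simp add: matrix_vector_mult_diff_distrib inner_diff_left inner_diff_right pos_def_inv_cancel[OF G]
          inner_commute)
    also have "\<dots> = (p k * q k - 2 * q k + 1) * (s k \<bullet> ?g)"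
      using pos by (simp add: p_def q_def scaling_ratio_def curvature_ratio_def field_simps)
    also have "\<dots> \<le> (\<epsilon>\<^sup>2 * w / L) * (s k \<bullet> ?g)"
      using elim pos by (intro mult_right_mono) auto
    also have "\<dots> \<le> (\<epsilon>\<^sup>2 * w / L) * (L * (norm (s k))\<^sup>2)"
    proof (intro mult_left_mono)
      have "s k \<bullet> ?g \<le> norm (s k) * norm ?g"
        by (rule norm_cauchy_schwarz)
      also have "\<dots> \<le> norm (s k) * (L * norm (s k))"
        by (intro mult_left_mono L) auto
      finally show "s k \<bullet> ?g \<le> L * (norm (s k))\<^sup>2"
        by (simp add: power2_eq_square mult_ac)
    qed (use \<epsilon> w L in auto)
    also have "\<dots> = w * (\<epsilon> * norm (s k))\<^sup>2"
      using L by (simp add: power_mult_distrib)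
    finally have "(norm (?b - ?g))\<^sup>2 \<le> (\<epsilon> * norm (s k))\<^sup>2"
      using w by simp
    then show ?case
      by (rule power2_le_imp_le) (use \<epsilon> in simp)
  qed
qed

text \<open>With \<open>u = g - G s\<close> and \<open>t = u\<^sup>T s / s\<^sup>T G s\<close> the two quotients in the defect are
  \<open>1 + (u\<^sup>T s + u\<^sup>T G\<^sup>-\<^sup>1 u) / g\<^sup>T s\<close> and \<open>1 + t\<close>; the bound \<open>e \<le> m / 2\<close> keeps
  \<open>t\<close> within \<open>1 / 2\<close> of \<open>0\<close>.\<close>

lemma secant_defect_le:
  assumes G: "pos_def G" and m: "0 < m" "\<And>v. m * (norm v)\<^sup>2 \<le> v \<bullet> (G *v v)"
    and s: "s \<noteq> 0" and err: "norm (g - G *v s) \<le> e * norm s" and e: "e \<le> m / 2"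
  shows "secant_defect G s g \<le> 5 * e / m"
proof -
  let ?W = "matrix_inv G"
  define u where "u = g - G *v s"
  define a where "a = s \<bullet> (G *v s)"
  define t where "t = (u \<bullet> s) / a"
  have ns: "0 < (norm s)\<^sup>2"
    using s by simp
  have a: "m * (norm s)\<^sup>2 \<le> a" and a0: "0 < a"
    using m(2)[of s] pos_def_pos[OF G s] by (auto simp: a_def)
  have g: "g = G *v s + u"
    by (simp add: u_def)
  have gs: "g \<bullet> s = a + u \<bullet> s"
    by (simp add: g inner_add_left inner_add_right a_def inner_commute)
  have e0: "0 \<le> e"
  proof -
    have "0 \<le> e * norm s"
      using err norm_ge_zero order_trans by blast
    then show ?thesis
      using s by (simp add: zero_le_mult_iff)
  qed
  have us: "\<bar>u \<bullet> s\<bar> \<le> e * (norm s)\<^sup>2"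
  proof -
    have "\<bar>u \<bullet> s\<bar> \<le> norm u * norm s"
      by (rule Cauchy_Schwarz_ineq2)
    also have "\<dots> \<le> (e * norm s) * norm s"
      using err by (intro mult_right_mono) (auto simp: u_def)
    finally show ?thesis
      by (simp add: power2_eq_square mult.assoc)
  qed
  have "\<bar>t\<bar> \<le> (e * (norm s)\<^sup>2) / (m * (norm s)\<^sup>2)"
    unfolding t_def abs_divide using us a a0 m ns by (intro frac_le) auto
  then have t: "\<bar>t\<bar> \<le> e / m"
    using s by simp
  have "e / m \<le> 1 / 2"
    using e m by (simp add: field_simps)
  with t have t': "\<bar>t\<bar> \<le> 1 / 2"
    by linarith
  have gs': "g \<bullet> s = a * (1 + t)"
    using a0 by (simp add: gs t_def field_simps)
  have uWu: "u \<bullet> (?W *v u) \<le> e / 2 * (norm s)\<^sup>2"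
  proof -
    have "u \<bullet> (?W *v u) \<le> (norm u)\<^sup>2 / m"
      by (rule pos_def_inv_upper_bound[OF G m])
    also have "\<dots> \<le> (e * norm s)\<^sup>2 / m"
      using err m e0 by (intro divide_right_mono power_mono) (auto simp: u_def)
    also have "\<dots> = (e * (norm s)\<^sup>2) * (e / m)"
      by (simp add: power2_eq_square)
    also have "\<dots> \<le> (e * (norm s)\<^sup>2) * (1 / 2)"
      using \<open>e / m \<le> 1 / 2\<close> e0 by (intro mult_left_mono) auto
    finally show ?thesis
      by simp
  qed
  have "g \<bullet> (?W *v g) = a + 2 * (u \<bullet> s) + u \<bullet> (?W *v u)"
    using pos_def_sym[OF pos_def_inverse[OF G], of "G *v s" u]
    by (simp add: g matrix_vector_right_distrib inner_add_left inner_add_right pos_def_inv_cancel[OF G]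
        a_def inner_commute)
  then have "(g \<bullet> (?W *v g)) / (g \<bullet> s) - 1 = (u \<bullet> s + u \<bullet> (?W *v u)) / (g \<bullet> s)"
  proof -
    have "g \<bullet> s \<noteq> 0"
      using gs' a0 t' by auto
    then have "X / (g \<bullet> s) - 1 = (X - g \<bullet> s) / (g \<bullet> s)" for X
      by (simp add: diff_divide_distrib)
    with \<open>g \<bullet> (?W *v g) = _\<close> show ?thesis
      by (simp add: gs)
  qed
  also have "\<dots> \<le> (e * (norm s)\<^sup>2 + e / 2 * (norm s)\<^sup>2) / (m * (norm s)\<^sup>2 / 2)"
  proof (rule frac_le)
    have "m * (norm s)\<^sup>2 * (1 / 2) \<le> a * (1 + t)"
      using a a0 t' by (intro mult_mono) auto
    then show "m * (norm s)\<^sup>2 / 2 \<le> g \<bullet> s"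
      by (simp add: gs')
  qed (use us uWu e0 m ns in auto)
  also have "\<dots> = 3 * (e / m)"
    using s m by (simp add: field_simps)
  finally have 1: "(g \<bullet> (?W *v g)) / (g \<bullet> s) - 1 \<le> 3 * (e / m)" .
  have "- ln (1 + t) = ln (1 / (1 + t))"
    using t' by (simp add: ln_div)
  also have "\<dots> \<le> 1 / (1 + t) - 1"
    using t' by (intro ln_le_minus_one) auto
  also have "\<dots> = - t / (1 + t)"
    using t' by (simp add: field_simps)
  also have "\<dots> \<le> \<bar>t\<bar> / (1 / 2)"
    using t' by (intro frac_le) auto
  finally have "- ln ((g \<bullet> s) / a) \<le> 2 * (e / m)"
    using t gs' a0 by simp
  with 1 show ?thesis
    by (simp add: secant_defect_def a_def)
qed

section \<open>Gradients and Hessians\<close>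

lemma has_derivative_grad:
  assumes "f differentiable (at x)"
  shows "(f has_derivative (\<lambda>h. grad f x \<bullet> h)) (at x)"
proof -
  obtain f' where f': "(f has_derivative f') (at x)"
    using assms by (auto simp: differentiable_def)
  then interpret linear f'
    by (rule has_derivative_linear)
  have "f' = (\<lambda>h. h \<bullet> (\<Sum>b\<in>Basis. f' b *\<^sub>R b))"
  proof
    fix h
    have "f' h = f' (\<Sum>b\<in>Basis. (h \<bullet> b) *\<^sub>R b)"
      by (simp add: euclidean_representation)
    also have "\<dots> = h \<bullet> (\<Sum>b\<in>Basis. f' b *\<^sub>R b)"
      by (simp add: sum scale inner_sum_right mult.commute)
    finally show "f' h = h \<bullet> (\<Sum>b\<in>Basis. f' b *\<^sub>R b)" .
  qed
  then have g: "GDERIV f x :> (\<Sum>b\<in>Basis. f' b *\<^sub>R b)"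
    using f' by (simp add: gderiv_def)
  have "grad f x = (\<Sum>b\<in>Basis. f' b *\<^sub>R b)"
    unfolding grad_def
  proof (rule the_equality)
    show "GDERIV f x :> (\<Sum>b\<in>Basis. f' b *\<^sub>R b)"
      by (rule g)
    fix y assume "GDERIV f x :> y"
    with g have "(\<lambda>h. h \<bullet> y) = (\<lambda>h. h \<bullet> (\<Sum>b\<in>Basis. f' b *\<^sub>R b))"
      unfolding gderiv_def by (rule has_derivative_unique[rotated])
    then show "y = (\<Sum>b\<in>Basis. f' b *\<^sub>R b)"
      by (metis vector_eq_ldot)
  qed
  with g have "GDERIV f x :> grad f x"
    by simp
  then show ?thesis
    by (simp add: gderiv_def inner_commute)
qed

lemma C2_has_derivative_grad:
  "twice_cont_differentiable f \<Longrightarrow> (f has_derivative (\<lambda>h. grad f x \<bullet> h)) (at x)"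
  by (simp add: twice_cont_differentiable_def has_derivative_grad)

lemma C2_grad_has_derivative:
  "twice_cont_differentiable f \<Longrightarrow> (grad f has_derivative (\<lambda>h. hessian f x *v h)) (at x)"
  using jacobian_works[of "grad f" "at x"] by (simp add: twice_cont_differentiable_def hessian_def)

lemma grad_linearization_error:
  assumes f: "twice_cont_differentiable f" and S: "convex S" "z \<in> S" "w \<in> S"
    and H: "\<And>v. v \<in> S \<Longrightarrow> matrix_onorm (hessian f v - G) \<le> e"
  shows "norm (grad f z - grad f w - G *v (z - w)) \<le> e * norm (z - w)"
proof -
  have "norm ((grad f z - G *v z) - (grad f w - G *v w)) \<le> e * norm (z - w)"
  proof (rule differentiable_bound[where f = "\<lambda>v. grad f v - G *v v", OF S(1) _ _ S(2,3)])
    fix v assume v: "v \<in> S"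
    show "((\<lambda>v. grad f v - G *v v) has_derivative (\<lambda>h. (hessian f v - G) *v h)) (at v within S)"
      unfolding matrix_vector_mult_diff_rdistrib
      by (intro has_derivative_diff has_derivative_at_withinI[OF C2_grad_has_derivative[OF f]]
          bounded_linear_imp_has_derivative matrix_vector_mul_bounded_linear)
    show "onorm (\<lambda>h. (hessian f v - G) *v h) \<le> e"
      using H[OF v] by (simp add: matrix_onorm_def)
  qed
  then show ?thesis
    by (simp add: matrix_vector_mult_diff_distrib algebra_simps)
qed

text \<open>The gradient of the remainder of the quadratic model at \<open>w\<close> is the error of the linearized
  gradient, so the mean value theorem between \<open>w\<close> and \<open>z\<close> applies.\<close>

lemma quadratic_model_error:
  assumes f: "twice_cont_differentiable f" and G: "transpose G = G"
    and S: "convex S" "z \<in> S" "w \<in> S"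
    and H: "\<And>v. v \<in> S \<Longrightarrow> matrix_onorm (hessian f v - G) \<le> e"
  shows "\<bar>f z - f w - grad f w \<bullet> (z - w) - 1/2 * ((z - w) \<bullet> (G *v (z - w)))\<bar> \<le> e * (norm (z - w))\<^sup>2"
proof -
  define \<phi> where "\<phi> v = f v - grad f w \<bullet> (v - w) - 1/2 * ((v - w) \<bullet> (G *v (v - w)))" for v
  let ?T = "S \<inter> cball w (norm (z - w))"
  have e: "0 \<le> e"
    using H[OF S(2)] onorm_pos_le[OF matrix_vector_mul_bounded_linear] unfolding matrix_onorm_def
    by (rule order_trans[rotated])
  have "norm (\<phi> z - \<phi> w) \<le> (e * norm (z - w)) * norm (z - w)"
  proof (rule differentiable_bound[where S = ?T])
    show "convex ?T" "w \<in> ?T" "z \<in> ?T"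
      using S by (auto intro: convex_Int simp: dist_norm norm_minus_commute)
    fix v assume v: "v \<in> ?T"
    let ?r = "grad f v - grad f w - G *v (v - w)"
    have "(\<phi> has_derivative (\<lambda>h. grad f v \<bullet> h - grad f w \<bullet> h
        - 1/2 * (h \<bullet> (G *v (v - w)) + (v - w) \<bullet> (G *v h)))) (at v within ?T)"
      unfolding \<phi>_def
      by (rule derivative_eq_intros has_derivative_at_withinI[OF C2_has_derivative_grad[OF f]]
            bounded_linear.has_derivative[OF matrix_vector_mul_bounded_linear] refl)+
         (simp add: fun_eq_iff algebra_simps)
    also have "(\<lambda>h. grad f v \<bullet> h - grad f w \<bullet> h - 1/2 * (h \<bullet> (G *v (v - w)) + (v - w) \<bullet> (G *v h)))
        = (\<lambda>h. ?r \<bullet> h)"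
      using inner_matrix_vec_commute[OF G, of "v - w"]
      by (simp add: fun_eq_iff inner_diff_left inner_diff_right inner_commute diff_divide_distrib)
    finally show "(\<phi> has_derivative (\<lambda>h. ?r \<bullet> h)) (at v within ?T)" .
    have "onorm (\<lambda>h. ?r \<bullet> h) \<le> norm ?r"
      by (rule onorm_bound) (auto simp: Cauchy_Schwarz_ineq2)
    also have "\<dots> \<le> e * norm (v - w)"
      using v S H by (intro grad_linearization_error[OF f S(1)]) auto
    also have "\<dots> \<le> e * norm (z - w)"
      using v e by (intro mult_left_mono) (auto simp: dist_norm norm_minus_commute)
    finally show "onorm (\<lambda>h. ?r \<bullet> h) \<le> e * norm (z - w)" .
  qed
  then show ?thesis
    by (simp add: \<phi>_def power2_eq_square algebra_simps)
qed

section \<open>Multipliers for the direction subproblem\<close>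

text \<open>If no convex combination of the gradients of the active functions vanished, a hyperplane would
  separate them from the origin, and its normal would be a direction in which all active functions,
  and hence the maximum, decrease.\<close>

lemma max_quadratic_minimizer_multipliers:
  fixes g :: "'m::finite \<Rightarrow> real^'n" and B :: "'m \<Rightarrow> real^'n^'n"
  assumes sym: "\<And>j. transpose (B j) = B j"
    and min: "is_arg_min (\<lambda>d. MAX j. g j \<bullet> d + 1/2 * (d \<bullet> (B j *v d))) (\<lambda>_. True) d"
  obtains l :: "'m \<Rightarrow> real" where "\<And>j. 0 \<le> l j" "sum l UNIV = 1"
    "(\<Sum>j\<in>UNIV. l j *\<^sub>R (g j + B j *v d)) = 0"
    "\<And>j. l j \<noteq> 0 \<Longrightarrow> g j \<bullet> d + 1/2 * (d \<bullet> (B j *v d)) = (MAX j. g j \<bullet> d + 1/2 * (d \<bullet> (B j *v d)))"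
proof -
  define \<phi> where "\<phi> j d = g j \<bullet> d + 1/2 * (d \<bullet> (B j *v d))" for j d
  define mx where "mx = (MAX j. \<phi> j d)"
  define A where "A = {j. \<phi> j d = mx}"
  define a where "a j = g j + B j *v d" for j
  define K where "K = {\<Sum>j\<in>UNIV. l j *\<^sub>R a j | l. (\<forall>j. 0 \<le> l j) \<and> sum l UNIV = 1 \<and> (\<forall>j. l j \<noteq> 0 \<longrightarrow> j \<in> A)}"
  have le: "\<phi> j d \<le> mx" for j
    unfolding mx_def by (intro Max_ge) auto
  have "mx \<in> range (\<lambda>j. \<phi> j d)"
    unfolding mx_def by (intro Max_in) auto
  then have "A \<noteq> {}"
    by (auto simp: A_def)
  have "0 \<in> convex hull (a ` A)"
  proof (rule ccontr)
    assume "0 \<notin> convex hull (a ` A)"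
    moreover have "closed (convex hull (a ` A))"
      by (intro compact_imp_closed finite_imp_compact_convex_hull) auto
    ultimately obtain u b where b: "0 < b" "\<And>y. y \<in> convex hull (a ` A) \<Longrightarrow> b < u \<bullet> y"
      using separating_hyperplane_closed_0[of "convex hull (a ` A)"] by auto
    have u: "b < u \<bullet> a j" if "j \<in> A" for j
      using that by (intro b(2) hull_inc) auto
    have expand: "\<phi> j (d - t *\<^sub>R u) = \<phi> j d - t * (u \<bullet> a j) + t\<^sup>2 / 2 * (u \<bullet> (B j *v u))" for j t
      using inner_matrix_vec_commute[OF sym, of j d u]
      by (simp add: \<phi>_def a_def matrix_vector_mult_diff_distrib matrix_vector_mult_scaleR inner_diff_left
          inner_diff_right inner_add_right power2_eq_square algebra_simps inner_commute)
    have "\<forall>\<^sub>F t in at_right 0. \<phi> j (d - t *\<^sub>R u) < mx" for j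
    proof (cases "j \<in> A")
      case True
      have "((\<lambda>t. - (u \<bullet> a j) + t / 2 * (u \<bullet> (B j *v u))) \<longlongrightarrow> - (u \<bullet> a j) + 0 / 2 * (u \<bullet> (B j *v u))) (at_right 0)"
        by (intro tendsto_intros) simp
      then have "\<forall>\<^sub>F t in at_right 0. - (u \<bullet> a j) + t / 2 * (u \<bullet> (B j *v u)) < 0"
        using u[OF True] b(1) by (intro order_tendstoD(2)) auto
      then show ?thesis
        using eventually_at_right_less[of "0::real"]
      proof eventually_elim
        case (elim t)
        have "\<phi> j (d - t *\<^sub>R u) = mx + t * (- (u \<bullet> a j) + t / 2 * (u \<bullet> (B j *v u)))"
          using True by (simp add: expand A_def power2_eq_square algebra_simps)
        then show ?case
          using elim by (simp add: mult_pos_neg)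
      qed
    next
      case False
      then have "\<phi> j d < mx"
        using le[of j] by (simp add: A_def)
      moreover have "((\<lambda>t. \<phi> j d - t * (u \<bullet> a j) + t\<^sup>2 / 2 * (u \<bullet> (B j *v u)))
          \<longlongrightarrow> \<phi> j d - 0 * (u \<bullet> a j) + 0\<^sup>2 / 2 * (u \<bullet> (B j *v u))) (at_right 0)"
        by (intro tendsto_intros) auto
      ultimately show ?thesis
        unfolding expand by (intro order_tendstoD(2)) auto
    qed
    then have "\<forall>\<^sub>F t in at_right 0. \<forall>j. \<phi> j (d - t *\<^sub>R u) < mx"
      by (rule eventually_all_finite)
    then obtain t where t: "\<And>j. \<phi> j (d - t *\<^sub>R u) < mx"
      using eventually_happens[of _ "at_right (0::real)"] by (auto simp: trivial_limit_at_right_real)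
    then have "(MAX j. \<phi> j (d - t *\<^sub>R u)) < mx"
      by (subst Max_less_iff) auto
    then show False
      using min by (auto simp: is_arg_min_def \<phi>_def mx_def)
  qed
  also have "convex hull (a ` A) \<subseteq> K"
  proof (rule hull_minimal)
    show "a ` A \<subseteq> K"
    proof
      fix y assume "y \<in> a ` A"
      then obtain i where i: "i \<in> A" "y = a i"
        by blast
      have "(\<Sum>j\<in>UNIV. (if j = i then 1 else 0) *\<^sub>R a j) = y"
        by (simp add: i if_distrib[of "\<lambda>c. c *\<^sub>R _"] cong: if_cong)
      then show "y \<in> K"
        unfolding K_def using i by (intro CollectI exI[of _ "\<lambda>j. if j = i then 1 else 0"]) auto
    qed
    show "convex K"
    proof (rule convexI)
      fix y z and s t :: real
      assume "y \<in> K" "z \<in> K" and st: "0 \<le> s" "0 \<le> t" "s + t = 1"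
      then obtain l l' where l: "\<And>j. 0 \<le> l j" "sum l UNIV = 1" "\<And>j. l j \<noteq> 0 \<Longrightarrow> j \<in> A" "y = (\<Sum>j\<in>UNIV. l j *\<^sub>R a j)"
        and l': "\<And>j. 0 \<le> l' j" "sum l' UNIV = 1" "\<And>j. l' j \<noteq> 0 \<Longrightarrow> j \<in> A" "z = (\<Sum>j\<in>UNIV. l' j *\<^sub>R a j)"
        unfolding K_def by blast
      have "s *\<^sub>R y + t *\<^sub>R z = (\<Sum>j\<in>UNIV. (s * l j + t * l' j) *\<^sub>R a j)"
        by (simp add: l(4) l'(4) scaleR_sum_right sum.distrib scaleR_add_left)
      moreover have "(\<Sum>j\<in>UNIV. s * l j + t * l' j) = 1"
        using l(2) l'(2) st by (simp add: sum.distrib flip: sum_distrib_left)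
      ultimately show "s *\<^sub>R y + t *\<^sub>R z \<in> K"
        unfolding K_def using l(1,3) l'(1,3) st
        by (intro CollectI exI[of _ "\<lambda>j. s * l j + t * l' j"]) (auto, metis add_0 mult_zero_right)
    qed
  qed
  finally obtain l where "\<And>j. 0 \<le> l j" "sum l UNIV = 1" "\<And>j. l j \<noteq> 0 \<Longrightarrow> j \<in> A"
    "0 = (\<Sum>j\<in>UNIV. l j *\<^sub>R a j)"
    unfolding K_def by blast
  then show thesis
    by (intro that[of l]) (auto simp: A_def a_def mx_def \<phi>_def)
qed

lemma convex_comb_le:
  fixes l a :: "'m::finite \<Rightarrow> real"
  assumes "\<And>j. 0 \<le> l j" "sum l UNIV = 1" "\<And>j. l j \<noteq> 0 \<Longrightarrow> a j \<le> c"
  shows "(\<Sum>j\<in>UNIV. l j * a j) \<le> c"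
proof -
  have "(\<Sum>j\<in>UNIV. l j * a j) \<le> (\<Sum>j\<in>UNIV. l j * c)"
  proof (rule sum_mono)
    fix j show "l j * a j \<le> l j * c"
      using assms(1,3)[of j] by (cases "l j = 0") (auto intro: mult_left_mono)
  qed
  then show ?thesis
    using assms(2) by (simp flip: sum_distrib_right)
qed

lemma convex_comb_ge:
  fixes l a :: "'m::finite \<Rightarrow> real"
  assumes "\<And>j. 0 \<le> l j" "sum l UNIV = 1" "\<And>j. l j \<noteq> 0 \<Longrightarrow> c \<le> a j"
  shows "c \<le> (\<Sum>j\<in>UNIV. l j * a j)"
  using convex_comb_le[OF assms(1,2), of "\<lambda>j. - a j" "- c"] assms(3) by (simp add: sum_negf)

section \<open>Rates of convergence of sequences\<close>

text \<open>Up to a constant, \<open>t k \<le> 2\<close> holds for at least half of the indices; instead of counting them, the factor \<open>q\<close> of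
  such a step is weakened to \<open>q powr (1 - t k / 2)\<close>, which is valid for every step.\<close>

lemma linear_decay_on_average:
  fixes V t :: "nat \<Rightarrow> real"
  assumes V: "\<And>k. 0 \<le> V k" and dec: "\<And>k. V (Suc k) \<le> V k"
    and t: "\<And>k. 0 \<le> t k" and avg: "\<And>N. (\<Sum>k<N. t k) \<le> A + real N"
    and q: "0 < q" "q < 1" and good: "\<And>k. t k \<le> 2 \<Longrightarrow> V (Suc k) \<le> q * V k"
  shows "V N \<le> V 0 * q powr ((real N - A) / 2)"
proof -
  have step: "V (Suc k) \<le> V k * q powr (1 - t k / 2)" for k
  proof (cases "t k \<le> 2")
    case True
    then have "V (Suc k) \<le> V k * q powr 1"
      using good[of k] q by (simp add: mult.commute)
    also have "\<dots> \<le> V k * q powr (1 - t k / 2)"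
      using q t V by (intro mult_left_mono powr_mono') auto
    finally show ?thesis .
  next
    case False
    have "V k * q powr 0 \<le> V k * q powr (1 - t k / 2)"
      using q V False by (intro mult_left_mono powr_mono') auto
    with dec[of k] q show ?thesis
      by simp
  qed
  have "V N \<le> V 0 * q powr (real N - (\<Sum>k<N. t k) / 2)"
  proof (induction N)
    case (Suc N)
    have "V (Suc N) \<le> V N * q powr (1 - t N / 2)"
      by (rule step)
    also have "\<dots> \<le> (V 0 * q powr (real N - (\<Sum>k<N. t k) / 2)) * q powr (1 - t N / 2)"
      using Suc by (intro mult_right_mono) auto
    also have "\<dots> = V 0 * q powr (real (Suc N) - (\<Sum>k<Suc N. t k) / 2)"
      by (simp add: powr_add [symmetric] algebra_simps add_divide_distrib)
    finally show ?case .
  qed (use q in simp)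
  also have "\<dots> \<le> V 0 * q powr ((real N - A) / 2)"
    using avg[of N] V q by (intro mult_left_mono powr_mono') (auto simp: field_simps)
  finally show ?thesis .
qed

lemma linear_convergence_of_steps:
  fixes x :: "nat \<Rightarrow> 'a::real_normed_vector"
  assumes lim: "x \<longlonglongrightarrow> z" and r: "0 < r" "r < 1"
    and step: "\<And>k. norm (x (Suc k) - x k) \<le> C * r ^ k"
  shows "norm (x k - z) \<le> C / (1 - r) * r ^ k"
proof -
  have C: "0 \<le> C"
    using order_trans[OF norm_ge_zero step[of 0]] by simp
  have bound: "norm (x (k + n) - x k) \<le> C / (1 - r) * (r ^ k - r ^ (k + n))" for n
  proof (induction n)
    case (Suc n)
    have "norm (x (k + Suc n) - x k) \<le> norm (x (Suc (k + n)) - x (k + n)) + norm (x (k + n) - x k)"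
      using norm_triangle_ineq[of "x (Suc (k + n)) - x (k + n)" "x (k + n) - x k"] by simp
    also have "\<dots> \<le> C * r ^ (k + n) + C / (1 - r) * (r ^ k - r ^ (k + n))"
      by (intro add_mono step Suc)
    also have "C * r ^ (k + n) = C / (1 - r) * (r ^ (k + n) - r ^ (k + Suc n))"
      using r by (simp add: field_simps)
    finally show ?case
      by (simp add: algebra_simps)
  qed simp
  have "(\<lambda>n. norm (x (n + k) - x k)) \<longlonglongrightarrow> norm (z - x k)"
    by (intro tendsto_intros LIMSEQ_ignore_initial_segment lim)
  moreover have "norm (x (n + k) - x k) \<le> C / (1 - r) * r ^ k" for n
  proof -
    have "C / (1 - r) * (r ^ k - r ^ (k + n)) \<le> C / (1 - r) * r ^ k"
      using C r by (intro mult_left_mono) auto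
    with bound[of n] show ?thesis
      by (simp add: add.commute)
  qed
  ultimately have "norm (z - x k) \<le> C / (1 - r) * r ^ k"
    by (intro LIMSEQ_le_const2) auto
  then show ?thesis
    by (simp add: norm_minus_commute)
qed

lemma superlinear_convergence_of_steps:
  fixes x :: "nat \<Rightarrow> 'a::real_normed_vector"
  assumes lim: "x \<longlonglongrightarrow> z"
    and step: "\<And>\<epsilon>. 0 < \<epsilon> \<Longrightarrow>
      \<forall>\<^sub>F k in sequentially. norm (x (Suc (Suc k)) - x (Suc k)) \<le> \<epsilon> * norm (x (Suc k) - x k)"
  shows "(\<lambda>k. norm (x (Suc k) - z) / norm (x k - z)) \<longlonglongrightarrow> 0"
proof (rule LIMSEQ_I)
  fix \<eta> :: real assume \<eta>: "0 < \<eta>"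
  define \<epsilon> where "\<epsilon> = min (1 / 4) (\<eta> / 8)"
  have \<epsilon>: "0 < \<epsilon>" "\<epsilon> \<le> 1 / 4" "4 * \<epsilon> < \<eta>"
    using \<eta> by (auto simp: \<epsilon>_def)
  define \<sigma> where "\<sigma> k = norm (x (Suc k) - x k)" for k
  obtain K where K: "\<And>k. K \<le> k \<Longrightarrow> \<sigma> (Suc k) \<le> \<epsilon> * \<sigma> k"
    using step[OF \<epsilon>(1)] by (auto simp: \<sigma>_def eventually_sequentially)
  have "norm (x (Suc k) - z) \<le> 4 * \<epsilon> * norm (x k - z)" if k: "K \<le> k" for k
  proof -
    \<comment> \<open>the steps after step \<open>k\<close> have total length at most \<open>2 \<epsilon> \<sigma> k\<close>, by telescoping\<close>
    have bound: "norm (x (Suc k + n) - x (Suc k)) \<le> 2 * \<epsilon> * (\<sigma> k - \<sigma> (k + n))" for n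
    proof (induction n)
      case (Suc n)
      have "norm (x (Suc k + Suc n) - x (Suc k)) \<le> \<sigma> (Suc (k + n)) + norm (x (Suc k + n) - x (Suc k))"
        using norm_triangle_ineq[of "x (Suc (Suc k + n)) - x (Suc k + n)" "x (Suc k + n) - x (Suc k)"]
        by (simp add: \<sigma>_def)
      also have "\<dots> \<le> \<sigma> (Suc (k + n)) + 2 * \<epsilon> * (\<sigma> k - \<sigma> (k + n))"
        using Suc by simp
      also have "\<sigma> (Suc (k + n)) \<le> 2 * \<epsilon> * (\<sigma> (k + n) - \<sigma> (Suc (k + n)))"
      proof -
        have "\<sigma> (Suc (k + n)) \<le> \<epsilon> * \<sigma> (k + n)"
          using k by (intro K) simp
        moreover have "2 * \<epsilon> * \<sigma> (Suc (k + n)) \<le> 1 * \<sigma> (Suc (k + n))"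
          using \<epsilon> by (intro mult_right_mono) (auto simp: \<sigma>_def)
        moreover have "2 * \<epsilon> * \<sigma> (Suc (k + n)) \<le> 2 * \<epsilon> * (\<epsilon> * \<sigma> (k + n))"
          using \<open>\<sigma> (Suc (k + n)) \<le> \<epsilon> * \<sigma> (k + n)\<close> \<epsilon> by (intro mult_left_mono) auto
        moreover have "2 * \<epsilon> * (\<epsilon> * \<sigma> (k + n)) \<le> 1 * (\<epsilon> * \<sigma> (k + n))"
          using \<epsilon> by (intro mult_right_mono) (auto simp: \<sigma>_def)
        ultimately show ?thesis
          by (simp add: right_diff_distrib)
      qed
      finally show ?case
        by (simp add: algebra_simps)
    qed simp
    have "(\<lambda>n. norm (x (n + Suc k) - x (Suc k))) \<longlonglongrightarrow> norm (z - x (Suc k))"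
      by (intro tendsto_intros LIMSEQ_ignore_initial_segment lim)
    moreover have "norm (x (n + Suc k) - x (Suc k)) \<le> 2 * \<epsilon> * \<sigma> k" for n
    proof -
      have "2 * \<epsilon> * (\<sigma> k - \<sigma> (k + n)) \<le> 2 * \<epsilon> * \<sigma> k"
        using \<epsilon> by (intro mult_left_mono) (auto simp: \<sigma>_def)
      with bound[of n] show ?thesis
        by (simp add: add.commute)
    qed
    ultimately have next_le: "norm (x (Suc k) - z) \<le> 2 * \<epsilon> * \<sigma> k"
      by (subst norm_minus_commute, intro LIMSEQ_le_const2) auto
    have "\<sigma> k \<le> norm (x (Suc k) - z) + norm (x k - z)"
      using norm_triangle_ineq4[of "x (Suc k) - z" "x k - z"] by (simp add: \<sigma>_def)
    also have "\<dots> \<le> 2 * \<epsilon> * \<sigma> k + norm (x k - z)"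
      using next_le by simp
    also have "2 * \<epsilon> * \<sigma> k \<le> 1 / 2 * \<sigma> k"
      using \<epsilon> by (intro mult_right_mono) (auto simp: \<sigma>_def)
    finally have "\<sigma> k \<le> 2 * norm (x k - z)"
      by simp
    then have "2 * \<epsilon> * \<sigma> k \<le> 2 * \<epsilon> * (2 * norm (x k - z))"
      using \<epsilon> by (intro mult_left_mono) auto
    with next_le show ?thesis
      by simp
  qed
  then have "norm (x (Suc k) - z) / norm (x k - z) \<le> 4 * \<epsilon>" if "K \<le> k" for k
    using that \<epsilon> by (cases "x k = z") (simp_all add: divide_le_eq)
  then have "norm (norm (x (Suc k) - z) / norm (x k - z) - 0) < \<eta>" if "K \<le> k" for k
    using that \<epsilon> by (simp add: le_less_trans[of _ "4 * \<epsilon>"])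
  then show "\<exists>K. \<forall>k\<ge>K. norm (norm (x (Suc k) - z) / norm (x k - z) - 0) < \<eta>"
    by blast
qed

section \<open>Constants uniform in the objectives\<close>

lemma matrices_norm_bound:
  fixes A :: "'m::finite \<Rightarrow> real^'n^'n"
  shows "\<exists>L>0. \<forall>j v. norm (A j *v v) \<le> L * norm v"
proof -
  have "\<forall>j. \<exists>l. 0 < l \<and> (\<forall>v. norm (A j *v v) \<le> l * norm v)"
    using matrix_vec_norm_bound by blast
  from choice[OF this] obtain L where L: "\<And>j. 0 < L j" "\<And>j v. norm (A j *v v) \<le> L j * norm v"
    by blast
  have "norm (A j *v v) \<le> sum L UNIV * norm v" for j v
    using L by (intro order_trans[OF L(2)] mult_right_mono member_le_sum) (auto intro: less_imp_le)
  moreover have "0 < sum L UNIV"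
    using L by (intro sum_pos) auto
  ultimately show ?thesis
    by blast
qed

lemma positive_family_lower_bound:
  fixes b :: "'m::finite \<Rightarrow> real"
  assumes "\<And>j. 0 < b j" shows "\<exists>c>0. \<forall>j. c \<le> b j"
  using assms by (intro exI[of _ "Min (range b)"]) auto

lemma pos_defs_lower_bound:
  fixes A :: "'m::finite \<Rightarrow> real^'n^'n"
  assumes "\<And>j. pos_def (A j)"
  shows "\<exists>w>0. \<forall>j v. w * (norm v)\<^sup>2 \<le> v \<bullet> (A j *v v)"
proof -
  obtain w where w: "\<And>j. 0 < w j" "\<And>j v. w j * (norm v)\<^sup>2 \<le> v \<bullet> (A j *v v)"
    using pos_def_lower_bound[OF assms] by metis
  obtain c where "0 < c" "\<And>j. c \<le> w j"
    using positive_family_lower_bound[of w] w(1) by auto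
  moreover have "c * (norm v)\<^sup>2 \<le> v \<bullet> (A j *v v)" for j v
    using w(2)[where j = j and v = v] mult_right_mono[OF \<open>c \<le> w j\<close>, of "(norm v)\<^sup>2"] by simp
  ultimately show ?thesis
    by blast
qed

lemma norm_bounds_of_curvature_defects:
  fixes G :: "'m::finite \<Rightarrow> real^'n^'n"
  assumes G: "\<And>j. pos_def (G j)"
  shows "\<exists>\<beta>>0. \<exists>\<Lambda>>0. \<forall>j B s. pos_def B \<longrightarrow> s \<noteq> 0 \<longrightarrow> curvature_defect (G j) B s \<le> T \<longrightarrow>
    \<beta> * (norm s)\<^sup>2 \<le> s \<bullet> (B *v s) \<and> norm (B *v s) \<le> \<Lambda> * norm s"
proof -
  obtain \<beta> \<Lambda> where *: "\<And>j. 0 < \<beta> j" "\<And>j. 0 < \<Lambda> j"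
    "\<And>j B s. pos_def B \<Longrightarrow> s \<noteq> 0 \<Longrightarrow> curvature_defect (G j) B s \<le> T \<Longrightarrow>
      \<beta> j * (norm s)\<^sup>2 \<le> s \<bullet> (B *v s) \<and> norm (B *v s) \<le> \<Lambda> j * norm s"
  proof -
    define P where "P j b l \<longleftrightarrow> 0 < b \<and> 0 < l \<and> (\<forall>B s. pos_def B \<longrightarrow> s \<noteq> 0 \<longrightarrow>
      curvature_defect (G j) B s \<le> T \<longrightarrow> b * (norm s)\<^sup>2 \<le> s \<bullet> (B *v s) \<and> norm (B *v s) \<le> l * norm s)" for j b l
    have "\<exists>b l. P j b l" for j
      using norm_bounds_of_curvature_defect[OF G[of j], of T] unfolding P_def by blast
    then obtain \<beta> \<Lambda> where "\<And>j. P j (\<beta> j) (\<Lambda> j)"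
      by metis
    then show thesis
      by (intro that[of \<beta> \<Lambda>]) (simp_all add: P_def)
  qed
  obtain c where c: "0 < c" "\<And>j. c \<le> \<beta> j"
    using positive_family_lower_bound[of \<beta>] *(1) by auto
  have "0 < sum \<Lambda> UNIV"
    using * by (intro sum_pos) auto
  moreover have "c * (norm s)\<^sup>2 \<le> s \<bullet> (B *v s) \<and> norm (B *v s) \<le> sum \<Lambda> UNIV * norm s"
    if "pos_def B" "s \<noteq> 0" "curvature_defect (G j) B s \<le> T" for j B s
  proof -
    have "c * (norm s)\<^sup>2 \<le> \<beta> j * (norm s)\<^sup>2"
      using c by (intro mult_right_mono) auto
    moreover have "\<Lambda> j * norm s \<le> sum \<Lambda> UNIV * norm s"
      using * by (intro mult_right_mono member_le_sum) (auto intro: less_imp_le)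
    ultimately show ?thesis
      using *(3)[OF that] by linarith
  qed
  ultimately show ?thesis
    using c(1) by blast
qed

section \<open>Convergent runs of the algorithm\<close>

lemma cgrad_le_maxdir: "cgrad F j z \<bullet> v \<le> maxdir F z v"
  unfolding maxdir_def by (intro Max_ge) auto

lemma maxdir_attained: "\<exists>j. maxdir F z v = cgrad F j z \<bullet> v"
proof -
  have "maxdir F z v \<in> range (\<lambda>j. cgrad F j z \<bullet> v)"
    unfolding maxdir_def by (intro Max_in) auto
  then show ?thesis
    by blast
qed

lemma not_pareto_critical_convex_comb_nonzero:
  assumes nc: "\<not> pareto_critical F z" and l: "\<And>j. 0 \<le> l j" "sum l UNIV = 1"
  shows "(\<Sum>j\<in>UNIV. l j *\<^sub>R cgrad F j z) \<noteq> 0"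
proof
  assume 0: "(\<Sum>j\<in>UNIV. l j *\<^sub>R cgrad F j z) = 0"
  obtain v where v: "\<And>j. cgrad F j z \<bullet> v < 0"
    using nc by (auto simp: pareto_critical_def)
  have "maxdir F z v < 0"
    using maxdir_attained[of F z v] v by auto
  moreover have "(\<Sum>j\<in>UNIV. l j * (cgrad F j z \<bullet> v)) \<le> maxdir F z v"
    by (rule convex_comb_le[OF l cgrad_le_maxdir])
  moreover have "(\<Sum>j\<in>UNIV. l j * (cgrad F j z \<bullet> v)) = (\<Sum>j\<in>UNIV. l j *\<^sub>R cgrad F j z) \<bullet> v"
    by (simp add: inner_sum_left)
  ultimately show False
    by (simp add: 0)
qed

text \<open>The modulus of convexity \<open>m\<close> and the constants of the Hoelder condition are parameters, in order
  that all lemmas speak of the same ones.\<close>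

locale convergent_bfgs_run =
  fixes F :: "real^'n \<Rightarrow> real^'m"
    and \<rho> \<sigma> \<theta>min \<theta>max :: real
    and x d :: "nat \<Rightarrow> real^'n"
    and B :: "nat \<Rightarrow> 'm \<Rightarrow> real^'n^'n"
    and \<alpha> \<theta> :: "nat \<Rightarrow> real"
    and \<mu> :: "nat \<Rightarrow> real^'m"
    and xstar :: "real^'n"
    and m \<nu> M :: real
  assumes C2: "\<And>j. twice_cont_differentiable (\<lambda>z. F z $ j)"
    and rho: "0 < \<rho>" "\<rho> < 1/2"
    and sigma: "\<rho> < \<sigma>" "\<sigma> < 1"
    and theta: "0 < \<theta>min"
    and run: "bfgs_run F \<rho> \<sigma> \<theta>min \<theta>max x B d \<alpha> \<mu> \<theta>"
    and conv: "x \<longlonglongrightarrow> xstar"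
    and hess_pos: "\<And>j. pos_def (chess F j xstar)"
    and m: "0 < m" "\<And>j v. m * (norm v)\<^sup>2 \<le> v \<bullet> (chess F j xstar *v v)"
    and \<nu>: "0 < \<nu>" and M: "0 < M"
    and holder: "\<forall>\<^sub>F z in nhds xstar. \<forall>j.
      matrix_onorm (chess F j z - chess F j xstar) \<le> M * norm (z - xstar) powr \<nu>"
    and summ: "\<And>j. summable (\<lambda>k. reg_r F x \<mu> \<theta> k j)"
begin

abbreviation G :: "'m \<Rightarrow> real^'n^'n" where "G j \<equiv> chess F j xstar"
abbreviation g :: "'m \<Rightarrow> real^'n \<Rightarrow> real^'n" where "g \<equiv> cgrad F"
abbreviation s :: "nat \<Rightarrow> real^'n" where "s \<equiv> step_s x"
abbreviation \<gamma> :: "nat \<Rightarrow> 'm \<Rightarrow> real^'n" where "\<gamma> \<equiv> gamma_vec F x \<mu> \<theta>"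
abbreviation slope :: "nat \<Rightarrow> real" where "slope k \<equiv> maxdir F (x k) (d k)"

lemma
  shows B_0: "pos_def (B 0 j)"
    and d_min: "is_arg_min (subproblem_obj F (B k) (x k)) (\<lambda>_. True) (d k)"
    and not_critical: "\<not> pareto_critical F (x k)"
    and \<alpha>_pos: "0 < \<alpha> k"
    and admissible: "admissible_step F \<rho> \<sigma> (x k) (d k) (\<alpha> k)"
    and unit_step_first: "admissible_step F \<rho> \<sigma> (x k) (d k) 1 \<Longrightarrow> \<alpha> k = 1"
    and x_Suc: "x (Suc k) = x k + \<alpha> k *\<^sub>R d k"
    and \<mu>_simplex: "\<mu> k \<in> std_simplex"
    and \<theta>_ge: "\<theta>min \<le> \<theta> k"
    and B_Suc: "B (Suc k) j = bfgs_update (B k j) (s k) (\<gamma> k j)"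
  using run unfolding bfgs_run_def by auto

lemma s_eq: "s k = \<alpha> k *\<^sub>R d k"
  by (simp add: step_s_def x_Suc)

lemma norm_s: "norm (s k) = \<alpha> k * norm (d k)"
  using \<alpha>_pos[of k] by (simp add: s_eq)

lemma Armijo: "F (x (Suc k)) $ j \<le> F (x k) $ j + \<rho> * \<alpha> k * slope k"
  using admissible[of k] by (simp add: admissible_step_def x_Suc)

lemma Wolfe: "\<sigma> * slope k \<le> maxdir F (x (Suc k)) (d k)"
  using admissible[of k] by (simp add: admissible_step_def x_Suc)

lemma C2_grad: "twice_cont_differentiable (\<lambda>z. F z $ j)" "grad (\<lambda>z. F z $ j) = g j"
    "hessian (\<lambda>z. F z $ j) = chess F j"
  using C2 by (simp_all add: cgrad_def chess_def)

subsection \<open>The quadratic models with the Hessians at the limit\<close>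

text \<open>The errors of the linearized gradients and of the quadratic models at \<open>w\<close>, both with the fixed Hessians
  \<open>G\<^sub>j\<close> in place of those at \<open>w\<close>.\<close>

definition model_error_le :: "real \<Rightarrow> real^'n \<Rightarrow> real^'n \<Rightarrow> bool" where
  "model_error_le e z w \<longleftrightarrow> (\<forall>j. norm (g j z - g j w - G j *v (z - w)) \<le> e * norm (z - w) \<and>
    \<bar>F z $ j - F w $ j - g j w \<bullet> (z - w) - 1/2 * ((z - w) \<bullet> (G j *v (z - w)))\<bar> \<le> e * (norm (z - w))\<^sup>2)"

lemma model_error_Hoelder:
  obtains \<delta> where "0 < \<delta>"
    "\<And>R z w. R < \<delta> \<Longrightarrow> norm (z - xstar) \<le> R \<Longrightarrow> norm (w - xstar) \<le> R \<Longrightarrow> model_error_le (M * R powr \<nu>) z w"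
proof -
  obtain \<delta> where \<delta>: "0 < \<delta>" "\<And>z j. dist z xstar < \<delta> \<Longrightarrow> matrix_onorm (chess F j z - G j) \<le> M * norm (z - xstar) powr \<nu>"
    using holder unfolding eventually_nhds_metric by blast
  show thesis
  proof (rule that[OF \<delta>(1)])
    fix R z w
    assume R: "R < \<delta>" "norm (z - xstar) \<le> R" "norm (w - xstar) \<le> R"
    let ?S = "cball xstar R"
    have zw: "z \<in> ?S" "w \<in> ?S"
      using R by (auto simp: dist_norm norm_minus_commute)
    have H: "matrix_onorm (hessian (\<lambda>z. F z $ j) v - G j) \<le> M * R powr \<nu>" if "v \<in> ?S" for v j
    proof -
      have v: "norm (v - xstar) \<le> R"
        using that by (auto simp: dist_norm norm_minus_commute)
      then have "matrix_onorm (chess F j v - G j) \<le> M * norm (v - xstar) powr \<nu>"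
        using R by (intro \<delta>(2)) (auto simp: dist_norm)
      also have "\<dots> \<le> M * R powr \<nu>"
        using v M \<nu> by (intro mult_left_mono powr_mono2) auto
      finally show ?thesis
        by (simp add: C2_grad)
    qed
    have "transpose (G j) = G j" for j
      using hess_pos by (simp add: pos_def_def)
    then show "model_error_le (M * R powr \<nu>) z w"
      unfolding model_error_le_def
      using grad_linearization_error[OF C2 convex_cball zw H] quadratic_model_error[OF C2 _ convex_cball zw H]
      unfolding C2_grad by blast
  qed
qed

lemma eventually_model_error_le:
  assumes \<epsilon>: "0 < \<epsilon>" and z: "z \<longlonglongrightarrow> xstar" and w: "w \<longlonglongrightarrow> xstar"
  shows "\<forall>\<^sub>F k in sequentially. model_error_le \<epsilon> (z k) (w k)"
proof -
  obtain \<delta> where \<delta>: "0 < \<delta>"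
    "\<And>R z w. R < \<delta> \<Longrightarrow> norm (z - xstar) \<le> R \<Longrightarrow> norm (w - xstar) \<le> R \<Longrightarrow> model_error_le (M * R powr \<nu>) z w"
    by (rule model_error_Hoelder) (rule that)
  define R where "R = min (\<delta> / 2) ((\<epsilon> / M) powr (1 / \<nu>))"
  have R: "0 < R" "R < \<delta>"
    using \<delta> \<epsilon> M by (auto simp: R_def)
  have "R powr \<nu> \<le> ((\<epsilon> / M) powr (1 / \<nu>)) powr \<nu>"
    using R \<nu> by (intro powr_mono2) (auto simp: R_def)
  also have "\<dots> = \<epsilon> / M"
    using \<nu> \<epsilon> M by (simp add: powr_powr)
  finally have MR: "M * R powr \<nu> \<le> \<epsilon>"
    using M by (simp add: field_simps)
  have "\<forall>\<^sub>F k in sequentially. dist (z k) xstar < R" "\<forall>\<^sub>F k in sequentially. dist (w k) xstar < R"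
    using tendstoD[OF z R(1)] tendstoD[OF w R(1)] .
  then show ?thesis
  proof eventually_elim
    case (elim k)
    then have "model_error_le (M * R powr \<nu>) (z k) (w k)"
      by (intro \<delta>(2)[OF R(2)]) (auto simp: dist_norm)
    moreover have "M * R powr \<nu> * c \<le> \<epsilon> * c" if "0 \<le> c" for c
      using MR that by (rule mult_right_mono)
    ultimately show ?case
      unfolding model_error_le_def by (meson norm_ge_zero order_trans zero_le_power2)
  qed
qed

lemma x_Suc_tendsto: "(\<lambda>k. x (Suc k)) \<longlonglongrightarrow> xstar"
  using conv by (rule LIMSEQ_Suc)

subsection \<open>Well-definedness and multipliers\<close>

text \<open>With \<open>Q = \<Sum>\<^sub>j l\<^sub>j d\<^sup>T B\<^sub>j d\<close>, stationarity gives \<open>\<Sum>\<^sub>j l\<^sub>j \<nabla>F\<^sub>j\<^sup>T d = - Q\<close>. Since the weights live on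
  active indices, the optimal value of the subproblem is \<open>- Q / 2\<close>.\<close>

lemma multipliers:
  assumes B: "\<And>j. pos_def (B k j)"
  obtains l where "\<And>j. 0 \<le> l j" "sum l UNIV = 1"
    "(\<Sum>j\<in>UNIV. l j *\<^sub>R (g j (x k) + B k j *v d k)) = 0"
    "- (\<Sum>j\<in>UNIV. l j * (d k \<bullet> (B k j *v d k))) \<le> slope k"
    "\<And>i. g i (x k) \<bullet> d k + 1/2 * (d k \<bullet> (B k i *v d k)) \<le> - 1/2 * (\<Sum>j\<in>UNIV. l j * (d k \<bullet> (B k j *v d k)))"
proof -
  define b where "b j = d k \<bullet> (B k j *v d k)" for j
  define v where "v = (MAX j. g j (x k) \<bullet> d k + 1/2 * b j)"
  have "transpose (B k j) = B k j" for j
    using B by (simp add: pos_def_def)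
  moreover have "is_arg_min (\<lambda>d. MAX j. g j (x k) \<bullet> d + 1/2 * (d \<bullet> (B k j *v d))) (\<lambda>_. True) (d k)"
    using d_min[of k] unfolding subproblem_obj_def [abs_def] .
  ultimately obtain l where l: "\<And>j. 0 \<le> l j" "sum l UNIV = 1"
    "(\<Sum>j\<in>UNIV. l j *\<^sub>R (g j (x k) + B k j *v d k)) = 0"
    "\<And>j. l j \<noteq> 0 \<Longrightarrow> g j (x k) \<bullet> d k + 1/2 * b j = v"
    unfolding b_def v_def by (rule max_quadratic_minimizer_multipliers) blast
  have "(\<Sum>j\<in>UNIV. l j *\<^sub>R (g j (x k) + B k j *v d k)) \<bullet> d k = 0"
    by (simp only: l(3) inner_zero_left)
  then have lg: "(\<Sum>j\<in>UNIV. l j * (g j (x k) \<bullet> d k)) = - (\<Sum>j\<in>UNIV. l j * b j)"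
    by (simp add: inner_sum_left inner_add_left ring_distribs sum.distrib b_def inner_commute[of "d k"])
  have "(\<Sum>j\<in>UNIV. l j * (g j (x k) \<bullet> d k)) \<le> slope k"
    by (rule convex_comb_le[OF l(1,2) cgrad_le_maxdir])
  then have low: "- (\<Sum>j\<in>UNIV. l j * b j) \<le> slope k"
    by (simp add: lg)
  have "v \<le> (\<Sum>j\<in>UNIV. l j * (g j (x k) \<bullet> d k + 1/2 * b j))"
    using l(4) by (intro convex_comb_ge[OF l(1,2)]) simp
  also have "\<dots> = (\<Sum>j\<in>UNIV. l j * (g j (x k) \<bullet> d k)) + 1/2 * (\<Sum>j\<in>UNIV. l j * b j)"
    by (simp add: ring_distribs sum.distrib sum_distrib_left mult_ac)
  finally have v: "v \<le> - 1/2 * (\<Sum>j\<in>UNIV. l j * b j)"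
    by (simp add: lg)
  have "g i (x k) \<bullet> d k + 1/2 * b i \<le> v" for i
    unfolding v_def by (intro Max_ge) auto
  with v low show thesis
    by (intro that[OF l(1-3)]) (auto simp: b_def intro: order_trans)
qed

lemma d_nonzero:
  assumes "\<And>j. pos_def (B k j)" shows "d k \<noteq> 0"
proof
  assume "d k = 0"
  moreover obtain l where "\<And>j. 0 \<le> l j" "sum l UNIV = 1"
    "(\<Sum>j\<in>UNIV. l j *\<^sub>R (g j (x k) + B k j *v d k)) = 0"
    by (rule multipliers[OF assms]) (rule that)
  ultimately show False
    using not_pareto_critical_convex_comb_nonzero[OF not_critical[of k], of l] by simp
qed

lemma reg_r_nonneg: "0 \<le> reg_r F x \<mu> \<theta> k j"
  using theta \<theta>_ge[of k] by (auto simp: reg_r_def intro!: add_nonneg_nonneg mult_nonneg_nonneg)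

text \<open>The regularization outweighs negative curvature, strictly so because no convex combination of
  the gradients vanishes at a point that is not Pareto critical.\<close>

lemma gamma_inner_s_pos:
  assumes "s k \<noteq> 0" shows "0 < \<gamma> k j \<bullet> s k"
proof -
  have "(\<Sum>i\<in>UNIV. (\<mu> k $ i) *\<^sub>R g i (x k)) \<noteq> 0"
    using \<mu>_simplex[of k]
    by (intro not_pareto_critical_convex_comb_nonzero[OF not_critical]) (auto simp: std_simplex_def)
  then have "0 < \<theta> k * norm (\<Sum>i\<in>UNIV. (\<mu> k $ i) *\<^sub>R g i (x k))"
    using theta \<theta>_ge[of k] by simp
  then have "0 < curv_eta F x k j + reg_r F x \<mu> \<theta> k j"
    unfolding reg_r_def by linarith
  then have "0 < (curv_eta F x k j + reg_r F x \<mu> \<theta> k j) * (norm (s k))\<^sup>2"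
    using assms by simp
  also have "\<dots> = \<gamma> k j \<bullet> s k"
    using assms by (simp add: gamma_vec_def curv_eta_def inner_add_left ring_distribs power2_norm_eq_inner)
  finally show ?thesis .
qed

lemma B_pos: "pos_def (B k j)"
proof (induction k arbitrary: j)
  case 0
  show ?case
    by (rule B_0)
next
  case (Suc k)
  have "s k \<noteq> 0"
    using d_nonzero[OF Suc] \<alpha>_pos[of k] by (simp add: s_eq)
  then show ?case
    unfolding B_Suc by (intro pos_def_bfgs_update Suc gamma_inner_s_pos)
qed

lemma d_nz: "d k \<noteq> 0"
  by (rule d_nonzero[OF B_pos])

lemma s_nz: "s k \<noteq> 0"
  using d_nz[of k] \<alpha>_pos[of k] by (simp add: s_eq)

lemma slope_le:
  assumes "\<And>j. \<beta> * (norm (d k))\<^sup>2 \<le> d k \<bullet> (B k j *v d k)"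
  shows "slope k \<le> - (\<beta> / 2 * (norm (d k))\<^sup>2)"
proof -
  obtain l where l: "\<And>j. 0 \<le> l j" "sum l UNIV = 1"
    "\<And>i. g i (x k) \<bullet> d k + 1/2 * (d k \<bullet> (B k i *v d k)) \<le> - 1/2 * (\<Sum>j\<in>UNIV. l j * (d k \<bullet> (B k j *v d k)))"
    by (rule multipliers[OF B_pos, of k]) (rule that)
  obtain i where i: "slope k = g i (x k) \<bullet> d k"
    using maxdir_attained by metis
  have "\<beta> * (norm (d k))\<^sup>2 \<le> (\<Sum>j\<in>UNIV. l j * (d k \<bullet> (B k j *v d k)))"
    by (rule convex_comb_ge[OF l(1,2) assms])
  then show ?thesis
    using l(3)[of i] pos_def_nonneg[OF B_pos, of "d k" k i] by (simp add: i)
qed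

lemma slope_nonpos: "slope k \<le> 0"
  using slope_le[of 0 k] pos_def_nonneg[OF B_pos] by simp

subsection \<open>The gap\<close>

text \<open>The minimum is the right choice because it is bounded by every convex combination of the
  differences, whatever multipliers an iteration produces. The maximum or a fixed combination would
  not be.\<close>

definition gap :: "real^'n \<Rightarrow> real" where
  "gap z = (MIN j. F z $ j - F xstar $ j)"

lemma gap_le: "gap z \<le> F z $ j - F xstar $ j"
  unfolding gap_def by (intro Min_le) auto

lemma gap_attained: "\<exists>j. gap z = F z $ j - F xstar $ j"
proof -
  have "gap z \<in> range (\<lambda>j. F z $ j - F xstar $ j)"
    unfolding gap_def by (intro Min_in) auto
  then show ?thesis
    by blast
qed

lemma F_limit_le: "F xstar $ j \<le> F (x k) $ j"
proof -
  have "F (x (Suc k)) $ j \<le> F (x k) $ j" for k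
    using Armijo[of k j] rho \<alpha>_pos[of k] slope_nonpos[of k]
      mult_nonneg_nonpos[of "\<rho> * \<alpha> k" "slope k"] by simp
  then have "decseq (\<lambda>k. F (x k) $ j)"
    by (rule decseq_SucI)
  moreover have "isCont (\<lambda>z. F z $ j) xstar"
    using C2_has_derivative_grad[OF C2] has_derivative_continuous by blast
  then have "(\<lambda>k. F (x k) $ j) \<longlonglongrightarrow> F xstar $ j"
    using conv by (rule isCont_tendsto_compose)
  ultimately show ?thesis
    by (rule decseq_ge)
qed

lemma gap_nonneg: "0 \<le> gap (x k)"
  using gap_attained[of "x k"] F_limit_le by auto

lemma gap_Suc: "gap (x (Suc k)) \<le> gap (x k) + \<rho> * \<alpha> k * slope k"
proof -
  obtain j where "gap (x k) = F (x k) $ j - F xstar $ j"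
    using gap_attained by blast
  then show ?thesis
    using gap_le[of "x (Suc k)" j] Armijo[of k j] by simp
qed

text \<open>For the component whose derivative along \<open>d\<close> is the slope, strong convexity gives an increase of
  at least \<open>m / 4 \<parallel>s\<parallel>\<^sup>2\<close> over the linear prediction. The Armijo condition allows this only if
  \<open>\<parallel>s\<parallel>\<^sup>2\<close> is at most of the order of \<open>- \<alpha> slope\<close>, and the gap is at least \<open>- \<rho> \<alpha> slope\<close>.\<close>

lemma eventually_step_le_gap:
  "\<forall>\<^sub>F k in sequentially. (norm (s k))\<^sup>2 \<le> 4 / (m * \<rho>) * gap (x k)"
proof -
  have "\<forall>\<^sub>F k in sequentially. model_error_le (m / 4) (x (Suc k)) (x k)"
    using m conv x_Suc_tendsto by (intro eventually_model_error_le) auto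
  then show ?thesis
  proof eventually_elim
    case (elim k)
    obtain j where j: "slope k = g j (x k) \<bullet> d k"
      using maxdir_attained by metis
    have "\<bar>F (x (Suc k)) $ j - F (x k) $ j - g j (x k) \<bullet> s k - 1/2 * (s k \<bullet> (G j *v s k))\<bar>
        \<le> m / 4 * (norm (s k))\<^sup>2"
      using elim by (simp add: model_error_le_def step_s_def)
    moreover have "g j (x k) \<bullet> s k = \<alpha> k * slope k"
      by (simp add: s_eq j)
    ultimately have "m / 4 * (norm (s k))\<^sup>2 \<le> F (x (Suc k)) $ j - F (x k) $ j - \<alpha> k * slope k"
      using m(2)[of "s k" j] by linarith
    also have "\<dots> \<le> \<rho> * \<alpha> k * slope k - \<alpha> k * slope k"
      using Armijo[of k j] by simp
    also have "\<dots> \<le> - (\<alpha> k * slope k)"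
      using rho \<alpha>_pos[of k] slope_nonpos[of k] mult_nonneg_nonpos[of "\<rho> * \<alpha> k" "slope k"] by simp
    finally have "\<rho> * (m / 4 * (norm (s k))\<^sup>2) \<le> \<rho> * (- (\<alpha> k * slope k))"
      using rho by (intro mult_left_mono) auto
    also have "\<dots> \<le> gap (x k)"
      using gap_Suc[of k] gap_nonneg[of "Suc k"] by (simp add: mult.assoc)
    finally show ?case
      using m rho by (simp add: field_simps)
  qed
qed

text \<open>Strong convexity between an iterate and the limit bounds each convex combination of the
  differences, and therefore the gap, by the norm of the corresponding combination of gradients.\<close>

lemma eventually_gap_le_grad:
  "\<forall>\<^sub>F k in sequentially. \<forall>l. (\<forall>j. 0 \<le> l j) \<longrightarrow> sum l UNIV = 1 \<longrightarrow>
     gap (x k) \<le> (norm (\<Sum>j\<in>UNIV. l j *\<^sub>R g j (x k)))\<^sup>2 / m"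
proof -
  have "\<forall>\<^sub>F k in sequentially. model_error_le (m / 4) xstar (x k)"
    using m conv by (intro eventually_model_error_le) auto
  then show ?thesis
  proof eventually_elim
    case (elim k)
    show ?case
    proof (intro allI impI)
      fix l :: "'m \<Rightarrow> real"
      assume l: "\<forall>j. 0 \<le> l j" "sum l UNIV = 1"
      define u where "u = xstar - x k"
      define gl where "gl = (\<Sum>j\<in>UNIV. l j *\<^sub>R g j (x k))"
      have "gap (x k) + m / 4 * (norm u)\<^sup>2 \<le> (\<Sum>j\<in>UNIV. l j * - (g j (x k) \<bullet> u))"
      proof (rule convex_comb_ge)
        fix j
        have "\<bar>F xstar $ j - F (x k) $ j - g j (x k) \<bullet> u - 1/2 * (u \<bullet> (G j *v u))\<bar> \<le> m / 4 * (norm u)\<^sup>2"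
          using elim by (simp add: model_error_le_def u_def)
        then show "gap (x k) + m / 4 * (norm u)\<^sup>2 \<le> - (g j (x k) \<bullet> u)"
          using m(2)[of u j] gap_le[of "x k" j] by linarith
      qed (use l in auto)
      also have "\<dots> = - (gl \<bullet> u)"
        by (simp add: gl_def inner_sum_left sum_negf)
      also have "\<dots> \<le> norm gl * norm u"
        using Cauchy_Schwarz_ineq2[of gl u] by linarith
      \<comment> \<open>completing the square\<close>
      also have "\<dots> = (norm gl)\<^sup>2 / m + m / 4 * (norm u)\<^sup>2 - (2 * norm gl - m * norm u)\<^sup>2 / (4 * m)"
        using m by (simp add: power2_eq_square field_simps)
      also have "\<dots> \<le> (norm gl)\<^sup>2 / m + m / 4 * (norm u)\<^sup>2"
        using m by simp
      finally show "gap (x k) \<le> (norm (\<Sum>j\<in>UNIV. l j *\<^sub>R g j (x k)))\<^sup>2 / m"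
        by (simp add: gl_def)
    qed
  qed
qed

subsection \<open>Step lengths and steps with linear decrease\<close>

text \<open>The curvature condition forces the directional derivative to change by at least
  \<open>(1 - \<sigma>) \<bar>slope\<bar>\<close>, which is of order \<open>\<parallel>d\<parallel>\<^sup>2\<close>, whereas Lipschitz continuity of the gradients
  allows a change of order \<open>\<alpha> \<parallel>d\<parallel>\<^sup>2\<close> only.\<close>

lemma eventually_step_length_ge:
  assumes \<beta>: "0 < \<beta>"
  shows "\<exists>c>0. \<forall>\<^sub>F k in sequentially. (\<forall>j. \<beta> * (norm (d k))\<^sup>2 \<le> d k \<bullet> (B k j *v d k)) \<longrightarrow> c \<le> \<alpha> k"
proof -
  obtain L where L: "0 < L" "\<And>j v. norm (G j *v v) \<le> L * norm v"
    using matrices_norm_bound[of G] by blast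
  define c where "c = (1 - \<sigma>) * \<beta> / (2 * (L + 1))"
  have "0 < c"
    using \<beta> sigma L by (simp add: c_def)
  moreover have "\<forall>\<^sub>F k in sequentially. model_error_le 1 (x (Suc k)) (x k)"
    using conv x_Suc_tendsto by (intro eventually_model_error_le) auto
  then have "\<forall>\<^sub>F k in sequentially. (\<forall>j. \<beta> * (norm (d k))\<^sup>2 \<le> d k \<bullet> (B k j *v d k)) \<longrightarrow> c \<le> \<alpha> k"
  proof eventually_elim
    case (elim k)
    show ?case
    proof
      assume "\<forall>j. \<beta> * (norm (d k))\<^sup>2 \<le> d k \<bullet> (B k j *v d k)"
      then have slope: "\<beta> / 2 * (norm (d k))\<^sup>2 \<le> - slope k"
        using slope_le[of \<beta> k] by simp
      obtain j where j: "maxdir F (x (Suc k)) (d k) = g j (x (Suc k)) \<bullet> d k"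
        using maxdir_attained by metis
      have "norm (g j (x (Suc k)) - g j (x k)) \<le> norm (g j (x (Suc k)) - g j (x k) - G j *v s k) + norm (G j *v s k)"
        by (metis diff_add_cancel norm_triangle_ineq)
      also have "\<dots> \<le> 1 * norm (s k) + L * norm (s k)"
        using elim L by (intro add_mono) (auto simp: model_error_le_def step_s_def)
      finally have diff: "norm (g j (x (Suc k)) - g j (x k)) \<le> (L + 1) * \<alpha> k * norm (d k)"
        by (simp add: norm_s algebra_simps)
      have "(g j (x (Suc k)) - g j (x k)) \<bullet> d k \<le> norm (g j (x (Suc k)) - g j (x k)) * norm (d k)"
        by (rule norm_cauchy_schwarz)
      also have "\<dots> \<le> (L + 1) * \<alpha> k * norm (d k) * norm (d k)"
        using diff by (intro mult_right_mono) auto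
      finally have "(g j (x (Suc k)) - g j (x k)) \<bullet> d k \<le> (L + 1) * \<alpha> k * (norm (d k))\<^sup>2"
        by (simp add: power2_eq_square)
      moreover have "g j (x k) \<bullet> d k \<le> slope k"
        by (rule cgrad_le_maxdir)
      ultimately have "\<sigma> * slope k - slope k \<le> (L + 1) * \<alpha> k * (norm (d k))\<^sup>2"
        using Wolfe[of k] by (simp add: j inner_diff_left)
      moreover have "(1 - \<sigma>) * (\<beta> / 2 * (norm (d k))\<^sup>2) \<le> (1 - \<sigma>) * - slope k"
        using slope sigma by (intro mult_left_mono) auto
      moreover have "(1 - \<sigma>) * - slope k = \<sigma> * slope k - slope k"
        by (simp add: algebra_simps)
      ultimately have "((1 - \<sigma>) * \<beta> / 2) * (norm (d k))\<^sup>2 \<le> ((L + 1) * \<alpha> k) * (norm (d k))\<^sup>2"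
        by simp
      then have "(1 - \<sigma>) * \<beta> / 2 \<le> (L + 1) * \<alpha> k"
        using d_nz[of k] by (simp add: mult_le_cancel_right)
      then show "c \<le> \<alpha> k"
        using L by (simp add: c_def field_simps)
    qed
  qed
  ultimately show ?thesis
    by blast
qed

text \<open>The gap is \<open>O(\<parallel>\<Sum>\<^sub>j l\<^sub>j B\<^sub>j d\<parallel>\<^sup>2)\<close>, hence \<open>O(\<parallel>d\<parallel>\<^sup>2)\<close> by the upper bound on the matrices; the
  decrease \<open>- \<rho> \<alpha> slope\<close> is at least of order \<open>\<parallel>d\<parallel>\<^sup>2\<close> by the lower bound.\<close>

lemma eventually_linear_decrease:
  assumes \<beta>: "0 < \<beta>" and \<Lambda>: "0 < \<Lambda>"
  shows "\<exists>q>0. q < 1 \<and> (\<forall>\<^sub>F k in sequentially.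
    (\<forall>j. \<beta> * (norm (s k))\<^sup>2 \<le> s k \<bullet> (B k j *v s k) \<and> norm (B k j *v s k) \<le> \<Lambda> * norm (s k)) \<longrightarrow>
    gap (x (Suc k)) \<le> q * gap (x k))"
proof -
  obtain c where c: "0 < c"
    "\<forall>\<^sub>F k in sequentially. (\<forall>j. \<beta> * (norm (d k))\<^sup>2 \<le> d k \<bullet> (B k j *v d k)) \<longrightarrow> c \<le> \<alpha> k"
    using eventually_step_length_ge[OF \<beta>] by blast
  define \<kappa> where "\<kappa> = \<rho> * c * \<beta> / 2 * m / \<Lambda>\<^sup>2"
  \<comment> \<open>the maximum keeps \<open>q\<close> positive even if \<open>\<kappa> > 1\<close>\<close>
  define q where "q = max (1 - \<kappa>) (1 / 2)"
  have \<kappa>: "0 < \<kappa>"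
    using rho c \<beta> m \<Lambda> by (simp add: \<kappa>_def)
  have "0 < q" "q < 1"
    using \<kappa> by (auto simp: q_def)
  moreover have "\<forall>\<^sub>F k in sequentially.
    (\<forall>j. \<beta> * (norm (s k))\<^sup>2 \<le> s k \<bullet> (B k j *v s k) \<and> norm (B k j *v s k) \<le> \<Lambda> * norm (s k)) \<longrightarrow>
    gap (x (Suc k)) \<le> q * gap (x k)"
    using c(2) eventually_gap_le_grad
  proof eventually_elim
    case (elim k)
    show ?case
    proof
      assume good: "\<forall>j. \<beta> * (norm (s k))\<^sup>2 \<le> s k \<bullet> (B k j *v s k) \<and> norm (B k j *v s k) \<le> \<Lambda> * norm (s k)"
      have low: "\<beta> * (norm (d k))\<^sup>2 \<le> d k \<bullet> (B k j *v d k)" for j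
      proof -
        have "(\<alpha> k)\<^sup>2 * (\<beta> * (norm (d k))\<^sup>2) \<le> (\<alpha> k)\<^sup>2 * (d k \<bullet> (B k j *v d k))"
          using good[rule_format, of j]
          by (simp add: s_eq matrix_vector_mult_scaleR power2_eq_square mult_ac abs_of_pos[OF \<alpha>_pos])
        then show ?thesis
          using \<alpha>_pos[of k] by (simp add: mult_le_cancel_left)
      qed
      have up: "norm (B k j *v d k) \<le> \<Lambda> * norm (d k)" for j
      proof -
        have "\<alpha> k * norm (B k j *v d k) \<le> \<alpha> k * (\<Lambda> * norm (d k))"
          using good[rule_format, of j] \<alpha>_pos[of k]
          by (simp add: norm_s s_eq matrix_vector_mult_scaleR mult_ac)
        then show ?thesis
          using \<alpha>_pos[of k] by (simp add: mult_le_cancel_left)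
      qed
      obtain l where l: "\<And>j. 0 \<le> l j" "sum l UNIV = 1"
        "(\<Sum>j\<in>UNIV. l j *\<^sub>R (g j (x k) + B k j *v d k)) = 0"
        by (rule multipliers[OF B_pos, of k]) (rule that)
      have "(\<Sum>j\<in>UNIV. l j *\<^sub>R g j (x k)) = - (\<Sum>j\<in>UNIV. l j *\<^sub>R (B k j *v d k))"
        using l(3) by (simp add: scaleR_add_right sum.distrib eq_neg_iff_add_eq_0)
      then have "norm (\<Sum>j\<in>UNIV. l j *\<^sub>R g j (x k)) \<le> (\<Sum>j\<in>UNIV. norm (l j *\<^sub>R (B k j *v d k)))"
        by (simp only: norm_minus_cancel norm_sum)
      also have "\<dots> = (\<Sum>j\<in>UNIV. l j * norm (B k j *v d k))"
        using l(1) by simp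
      also have "\<dots> \<le> \<Lambda> * norm (d k)"
        by (rule convex_comb_le[OF l(1,2) up])
      finally have "(norm (\<Sum>j\<in>UNIV. l j *\<^sub>R g j (x k)))\<^sup>2 / m \<le> (\<Lambda> * norm (d k))\<^sup>2 / m"
        using m by (intro divide_right_mono power_mono) auto
      then have "gap (x k) \<le> (\<Lambda> * norm (d k))\<^sup>2 / m"
        using elim(2) l(1,2) order_trans by blast
      then have "\<kappa> * gap (x k) \<le> \<kappa> * ((\<Lambda> * norm (d k))\<^sup>2 / m)"
        using \<kappa> by (intro mult_left_mono) auto
      also have "\<dots> = \<rho> * (c * (\<beta> / 2 * (norm (d k))\<^sup>2))"
        using m \<Lambda> by (simp add: \<kappa>_def power_mult_distrib)
      also have "\<dots> \<le> \<rho> * (\<alpha> k * - slope k)"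
        using elim(1) low slope_le[of \<beta> k] rho c \<beta> by (intro mult_left_mono mult_mono) auto
      finally have "gap (x (Suc k)) \<le> (1 - \<kappa>) * gap (x k)"
        using gap_Suc[of k] by (simp add: algebra_simps)
      also have "\<dots> \<le> q * gap (x k)"
        using gap_nonneg by (intro mult_right_mono) (auto simp: q_def)
      finally show "gap (x (Suc k)) \<le> q * gap (x k)" .
    qed
  qed
  ultimately show ?thesis
    by blast
qed

subsection \<open>Summation of the potential\<close>

definition secant_err :: "nat \<Rightarrow> 'm \<Rightarrow> real" where
  "secant_err k j = M * max (norm (x k - xstar)) (norm (x (Suc k) - xstar)) powr \<nu> + reg_r F x \<mu> \<theta> k j"

abbreviation defect :: "nat \<Rightarrow> 'm \<Rightarrow> real" where
  "defect k j \<equiv> curvature_defect (G j) (B k j) (s k)"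

lemma defect_nonneg: "0 \<le> defect k j"
  by (rule curvature_defect_bounds(1)[OF B_pos hess_pos s_nz])

lemma max_dist_tendsto: "(\<lambda>k. max (norm (x k - xstar)) (norm (x (Suc k) - xstar))) \<longlonglongrightarrow> 0"
proof -
  have "(\<lambda>k. max (norm (x k - xstar)) (norm (x (Suc k) - xstar))) \<longlonglongrightarrow> max (norm (xstar - xstar)) (norm (xstar - xstar))"
    by (intro tendsto_intros conv x_Suc_tendsto)
  then show ?thesis
    by simp
qed

lemma secant_err_tendsto: "(\<lambda>k. secant_err k j) \<longlonglongrightarrow> 0"
proof -
  have "(\<lambda>k. max (norm (x k - xstar)) (norm (x (Suc k) - xstar)) powr \<nu>) \<longlonglongrightarrow> 0 powr \<nu>"
    using max_dist_tendsto \<nu> by (intro tendsto_powr2) (auto simp: max_def)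
  from tendsto_add[OF tendsto_mult_left[OF this, of M] summable_LIMSEQ_zero[OF summ[of j]]]
  have "(\<lambda>k. secant_err k j) \<longlonglongrightarrow> M * 0 powr \<nu> + 0"
    unfolding secant_err_def .
  then show ?thesis
    by simp
qed

lemma eventually_secant_error:
  "\<forall>\<^sub>F k in sequentially. \<forall>j. norm (\<gamma> k j - G j *v s k) \<le> secant_err k j * norm (s k)"
proof -
  obtain \<delta> where \<delta>: "0 < \<delta>"
    "\<And>R z w. R < \<delta> \<Longrightarrow> norm (z - xstar) \<le> R \<Longrightarrow> norm (w - xstar) \<le> R \<Longrightarrow> model_error_le (M * R powr \<nu>) z w"
    by (rule model_error_Hoelder) (rule that)
  have "\<forall>\<^sub>F k in sequentially. max (norm (x k - xstar)) (norm (x (Suc k) - xstar)) < \<delta>"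
    using max_dist_tendsto \<delta>(1) by (rule order_tendstoD(2))
  then show ?thesis
  proof eventually_elim
    case (elim k)
    let ?R = "max (norm (x k - xstar)) (norm (x (Suc k) - xstar))"
    have err: "model_error_le (M * ?R powr \<nu>) (x (Suc k)) (x k)"
      using elim by (intro \<delta>(2)) auto
    show ?case
    proof
      fix j
      have "\<gamma> k j - G j *v s k = (g j (x (Suc k)) - g j (x k) - G j *v s k) + reg_r F x \<mu> \<theta> k j *\<^sub>R s k"
        by (simp add: gamma_vec_def grad_diff_def)
      then have "norm (\<gamma> k j - G j *v s k) \<le> norm (g j (x (Suc k)) - g j (x k) - G j *v s k) + norm (reg_r F x \<mu> \<theta> k j *\<^sub>R s k)"
        by (metis norm_triangle_ineq)
      also have "\<dots> \<le> M * ?R powr \<nu> * norm (s k) + reg_r F x \<mu> \<theta> k j * norm (s k)"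
        using err reg_r_nonneg[of k j] by (intro add_mono) (auto simp: model_error_le_def step_s_def)
      finally show "norm (\<gamma> k j - G j *v s k) \<le> secant_err k j * norm (s k)"
        by (simp add: secant_err_def ring_distribs)
    qed
  qed
qed

lemma eventually_defect_le:
  "\<forall>\<^sub>F k in sequentially. \<forall>j. defect k j
    \<le> bfgs_potential (G j) (B k j) - bfgs_potential (G j) (B (Suc k) j) + 5 / m * secant_err k j"
proof -
  have "\<forall>\<^sub>F k in sequentially. \<forall>j. secant_err k j < m / 2"
    using m by (intro eventually_all_finite order_tendstoD(2)[OF secant_err_tendsto]) auto
  then show ?thesis
    using eventually_secant_error
  proof eventually_elim
    case (elim k)
    show ?case
    proof
      fix j
      have "secant_defect (G j) (s k) (\<gamma> k j) \<le> 5 * secant_err k j / m"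
        using elim by (intro secant_defect_le[OF hess_pos m s_nz]) (auto intro: less_imp_le)
      moreover have "bfgs_potential (G j) (B (Suc k) j)
          = bfgs_potential (G j) (B k j) - defect k j + secant_defect (G j) (s k) (\<gamma> k j)"
        unfolding B_Suc by (rule bfgs_potential_update[OF B_pos hess_pos s_nz gamma_inner_s_pos[OF s_nz]])
      ultimately show "defect k j
          \<le> bfgs_potential (G j) (B k j) - bfgs_potential (G j) (B (Suc k) j) + 5 / m * secant_err k j"
        by simp
    qed
  qed
qed

lemma eventually_sum_defect_le:
  "\<forall>\<^sub>F K in sequentially. \<forall>j. \<exists>C. \<forall>N. (\<Sum>i<N. defect (K + i) j) \<le> C + (\<Sum>i<N. 5 / m * secant_err (K + i) j)"
proof -
  obtain K0 where K0: "\<And>k j. K0 \<le> k \<Longrightarrow> defect k j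
    \<le> bfgs_potential (G j) (B k j) - bfgs_potential (G j) (B (Suc k) j) + 5 / m * secant_err k j"
    using eventually_defect_le by (auto simp: eventually_sequentially)
  show ?thesis
    unfolding eventually_sequentially
  proof (intro exI[of _ K0] allI impI)
    fix K j assume K: "K0 \<le> K"
    obtain c where c: "\<And>B. pos_def B \<Longrightarrow> c \<le> bfgs_potential (G j) B"
      using bfgs_potential_bounded_below[OF hess_pos] by blast
    let ?\<psi> = "\<lambda>k. bfgs_potential (G j) (B k j)"
    have "(\<Sum>i<N. defect (K + i) j) \<le> (?\<psi> K - c) + (\<Sum>i<N. 5 / m * secant_err (K + i) j)" for N
    proof -
      have "(\<Sum>i<N. defect (K + i) j) \<le> (\<Sum>i<N. (?\<psi> (K + i) - ?\<psi> (K + Suc i)) + 5 / m * secant_err (K + i) j)"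
        using K0[of "K + _" j] K by (intro sum_mono) simp
      also have "\<dots> = (?\<psi> K - ?\<psi> (K + N)) + (\<Sum>i<N. 5 / m * secant_err (K + i) j)"
        using sum_lessThan_telescope'[of "\<lambda>i. ?\<psi> (K + i)" N] by (simp add: sum.distrib)
      finally show ?thesis
        using c[OF B_pos, of "K + N" j] by linarith
    qed
    then show "\<exists>C. \<forall>N. (\<Sum>i<N. defect (K + i) j) \<le> C + (\<Sum>i<N. 5 / m * secant_err (K + i) j)"
      by blast
  qed
qed

text \<open>From some index on the secant errors are so small that the total defect of \<open>N\<close> iterations is at most
  \<open>N\<close> plus a constant. The total over \<open>j\<close> exceeds \<open>2\<close> at no more than about half of the iterations, and at all others
  every single matrix is well behaved along the step, as the linear decrease requires.\<close>

lemma linear_convergence: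
  "\<exists>K C r. 0 < r \<and> r < 1 \<and> (\<forall>i. norm (x (K + i) - xstar) \<le> C * r ^ i)"
proof -
  let ?c = "real CARD('m)"
  obtain \<beta> \<Lambda> where \<beta>: "0 < \<beta>" "0 < \<Lambda>"
    "\<forall>j B s. pos_def B \<longrightarrow> s \<noteq> 0 \<longrightarrow> curvature_defect (G j) B s \<le> 2 \<longrightarrow>
      \<beta> * (norm s)\<^sup>2 \<le> s \<bullet> (B *v s) \<and> norm (B *v s) \<le> \<Lambda> * norm s"
    using norm_bounds_of_curvature_defects[of G 2, OF hess_pos] by (elim exE conjE) (rule that)
  obtain q where q: "0 < q" "q < 1" "\<forall>\<^sub>F k in sequentially.
    (\<forall>j. \<beta> * (norm (s k))\<^sup>2 \<le> s k \<bullet> (B k j *v s k) \<and> norm (B k j *v s k) \<le> \<Lambda> * norm (s k)) \<longrightarrow>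
    gap (x (Suc k)) \<le> q * gap (x k)"
    using eventually_linear_decrease[OF \<beta>(1,2)] by blast
  have "\<forall>\<^sub>F k in sequentially. \<forall>j. secant_err k j < m / (5 * ?c)"
    using m by (intro eventually_all_finite order_tendstoD(2)[OF secant_err_tendsto]) auto
  with q(3) eventually_step_le_gap
  have "\<forall>\<^sub>F k in sequentially.
    ((\<forall>j. \<beta> * (norm (s k))\<^sup>2 \<le> s k \<bullet> (B k j *v s k) \<and> norm (B k j *v s k) \<le> \<Lambda> * norm (s k)) \<longrightarrow>
      gap (x (Suc k)) \<le> q * gap (x k)) \<and>
    (norm (s k))\<^sup>2 \<le> 4 / (m * \<rho>) * gap (x k) \<and> (\<forall>j. 5 / m * secant_err k j \<le> 1 / ?c)"
  proof eventually_elim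
    case (elim k)
    have "5 / m * secant_err k j \<le> 5 / m * (m / (5 * ?c))" for j
      using elim(3) m by (intro mult_left_mono) (auto intro: less_imp_le)
    then show ?case
      using elim m by simp
  qed
  then obtain K1 where K1: "\<And>k. K1 \<le> k \<Longrightarrow>
      (\<forall>j. \<beta> * (norm (s k))\<^sup>2 \<le> s k \<bullet> (B k j *v s k) \<and> norm (B k j *v s k) \<le> \<Lambda> * norm (s k)) \<Longrightarrow>
      gap (x (Suc k)) \<le> q * gap (x k)"
    "\<And>k. K1 \<le> k \<Longrightarrow> (norm (s k))\<^sup>2 \<le> 4 / (m * \<rho>) * gap (x k)"
    "\<And>k j. K1 \<le> k \<Longrightarrow> 5 / m * secant_err k j \<le> 1 / ?c"
    unfolding eventually_sequentially by blast
  obtain K2 where K2: "\<And>K. K2 \<le> K \<Longrightarrow> \<forall>j. \<exists>C. \<forall>N. (\<Sum>i<N. defect (K + i) j) \<le> C + (\<Sum>i<N. 5 / m * secant_err (K + i) j)"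
    using eventually_sum_defect_le unfolding eventually_sequentially by blast
  define K where "K = max K1 K2"
  have "\<forall>j. \<exists>C. \<forall>N. (\<Sum>i<N. defect (K + i) j) \<le> C + (\<Sum>i<N. 5 / m * secant_err (K + i) j)"
    by (rule K2) (simp add: K_def)
  from choice[OF this] obtain C
    where C: "\<And>j N. (\<Sum>i<N. defect (K + i) j) \<le> C j + (\<Sum>i<N. 5 / m * secant_err (K + i) j)"
    by blast
  define t where "t i = (\<Sum>j\<in>UNIV. defect (K + i) j)" for i
  define V where "V i = gap (x (K + i))" for i
  define A where "A = sum C UNIV"
  have V_le: "V N \<le> V 0 * q powr ((real N - A) / 2)" for N
  proof (rule linear_decay_on_average[OF _ _ _ _ q(1,2), where t = t])
    fix k
    show "0 \<le> V k"
      by (simp add: V_def gap_nonneg)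
    show "V (Suc k) \<le> V k"
      using gap_Suc[of "K + k"] rho \<alpha>_pos[of "K + k"] slope_nonpos[of "K + k"]
        mult_nonneg_nonpos[of "\<rho> * \<alpha> (K + k)" "slope (K + k)"] by (simp add: V_def)
    show "0 \<le> t k"
      unfolding t_def by (intro sum_nonneg defect_nonneg)
    show "V (Suc k) \<le> q * V k" if "t k \<le> 2"
    proof -
      have "defect (K + k) j \<le> 2" for j
        using that member_le_sum[of j UNIV "defect (K + k)"] defect_nonneg by (simp add: t_def)
      then have "\<forall>j. \<beta> * (norm (s (K + k)))\<^sup>2 \<le> s (K + k) \<bullet> (B (K + k) j *v s (K + k)) \<and>
          norm (B (K + k) j *v s (K + k)) \<le> \<Lambda> * norm (s (K + k))"
        using \<beta>(3)[rule_format, OF B_pos s_nz] by blast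
      then show ?thesis
        using K1(1)[of "K + k"] by (simp add: V_def K_def)
    qed
  next
    fix N
    have "(\<Sum>k<N. t k) = (\<Sum>j\<in>UNIV. \<Sum>k<N. defect (K + k) j)"
      unfolding t_def by (rule sum.swap)
    also have "\<dots> \<le> (\<Sum>j\<in>UNIV. C j + real N / ?c)"
    proof (rule sum_mono)
      fix j
      have "(\<Sum>i<N. 5 / m * secant_err (K + i) j) \<le> (\<Sum>i<N. 1 / ?c)"
        by (intro sum_mono K1(3)) (simp add: K_def)
      with C[where j = j and N = N] show "(\<Sum>k<N. defect (K + k) j) \<le> C j + real N / ?c"
        by simp
    qed
    also have "\<dots> = A + real N"
      by (simp add: sum.distrib A_def)
    finally show "(\<Sum>k<N. t k) \<le> A + real N" .
  qed
  \<comment> \<open>half of the iterations count, and steps are of the order of the square root of the gap\<close>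
  define r where "r = q powr (1 / 4)"
  have r: "0 < r" "r < 1"
    using q powr_less_mono'[of q 0 "1 / 4"] by (auto simp: r_def)
  define C1 where "C1 = 4 / (m * \<rho>) * (V 0 * q powr (- A / 2))"
  have C1: "0 \<le> C1"
    using m rho by (simp add: C1_def V_def gap_nonneg)
  have step: "norm (x (K + Suc i) - x (K + i)) \<le> sqrt C1 * r ^ i" for i
  proof (rule power2_le_imp_le)
    have "(norm (x (K + Suc i) - x (K + i)))\<^sup>2 \<le> 4 / (m * \<rho>) * V i"
      using K1(2)[of "K + i"] by (simp add: V_def K_def step_s_def)
    also have "\<dots> \<le> 4 / (m * \<rho>) * (V 0 * q powr ((real i - A) / 2))"
      using m rho by (intro mult_left_mono V_le) auto
    also have "q powr ((real i - A) / 2) = q powr (- A / 2) * (r ^ i)\<^sup>2"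
      using q by (simp add: r_def power_mult [symmetric] powr_power powr_add [symmetric] field_simps)
    finally show "(norm (x (K + Suc i) - x (K + i)))\<^sup>2 \<le> (sqrt C1 * r ^ i)\<^sup>2"
      using C1 by (simp add: power_mult_distrib) (simp add: C1_def)
  qed (use C1 r in auto)
  have "(\<lambda>i. x (K + i)) \<longlonglongrightarrow> xstar"
    using LIMSEQ_ignore_initial_segment[OF conv, of K] by (simp add: add.commute)
  from linear_convergence_of_steps[OF this r step] r show ?thesis
    by blast
qed

lemma summable_secant_err: "summable (\<lambda>k. secant_err k j)"
proof -
  obtain K C r where r: "0 < r" "r < 1" and lin: "\<And>i. norm (x (K + i) - xstar) \<le> C * r ^ i"
    using linear_convergence by blast
  have C: "0 \<le> C"
    using order_trans[OF norm_ge_zero lin[of 0]] by simp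
  let ?R = "\<lambda>k. max (norm (x k - xstar)) (norm (x (Suc k) - xstar))"
  have "summable (\<lambda>i. M * ?R (i + K) powr \<nu>)"
  proof (rule summable_comparison_test')
    show "summable (\<lambda>i. M * (C powr \<nu> * (r powr \<nu>) ^ i))"
      using r \<nu> powr_less_mono2[of \<nu> r 1] by (intro summable_mult summable_geometric) auto
    fix i
    have "norm (x (Suc (i + K)) - xstar) \<le> C * r ^ Suc i"
      using lin[of "Suc i"] by (simp add: add.commute)
    also have "\<dots> \<le> C * r ^ i"
      using r C by (intro mult_left_mono power_decreasing) auto
    finally have "?R (i + K) \<le> C * r ^ i"
      using lin[of i] by (simp add: add.commute)
    then have "?R (i + K) powr \<nu> \<le> (C * r ^ i) powr \<nu>"
      using \<nu> by (intro powr_mono2) (auto simp: le_max_iff_disj)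
    also have "\<dots> = C powr \<nu> * (r powr \<nu>) ^ i"
      using C r by (simp add: powr_mult powr_power powr_realpow [symmetric] powr_powr mult.commute)
    finally show "norm (M * ?R (i + K) powr \<nu>) \<le> M * (C powr \<nu> * (r powr \<nu>) ^ i)"
      using M by (simp add: abs_mult)
  qed
  then have "summable (\<lambda>k. M * ?R k powr \<nu>)"
    by (rule summable_iff_shift[THEN iffD1])
  then show ?thesis
    unfolding secant_err_def using summ by (rule summable_add)
qed

subsection \<open>The Dennis--More condition and unit steps\<close>

lemma defect_tendsto: "(\<lambda>k. defect k j) \<longlonglongrightarrow> 0"
proof -
  obtain K where "\<forall>j. \<exists>C. \<forall>N. (\<Sum>i<N. defect (K + i) j) \<le> C + (\<Sum>i<N. 5 / m * secant_err (K + i) j)"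
    using eventually_happens'[OF sequentially_bot eventually_sum_defect_le] by blast
  then obtain C where C: "\<And>N. (\<Sum>i<N. defect (K + i) j) \<le> C + (\<Sum>i<N. 5 / m * secant_err (K + i) j)"
    by blast
  have err: "summable (\<lambda>i. 5 / m * secant_err (K + i) j)"
    using summable_ignore_initial_segment[OF summable_secant_err[of j], of K]
    by (intro summable_mult) (simp add: add.commute)
  have err0: "0 \<le> 5 / m * secant_err k j" for k
    using m M reg_r_nonneg[of k j] by (simp add: secant_err_def)
  have "(\<Sum>i<N. defect (K + i) j) \<le> C + (\<Sum>i. 5 / m * secant_err (K + i) j)" for N
    using C[of N] sum_le_suminf[OF err, of "{..<N}"] err0 by fastforce
  then have "summable (\<lambda>i. defect (K + i) j)"
    by (intro summableI_nonneg_bounded defect_nonneg)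
  then have "(\<lambda>i. defect (i + K) j) \<longlonglongrightarrow> 0"
    by (simp add: summable_LIMSEQ_zero add.commute)
  then show ?thesis
    by (rule LIMSEQ_offset)
qed

lemma eventually_Dennis_More:
  assumes \<epsilon>: "0 < \<epsilon>"
  shows "\<forall>\<^sub>F k in sequentially. \<forall>j. norm (B k j *v d k - G j *v d k) \<le> \<epsilon> * norm (d k)"
proof (rule eventually_all_finite)
  fix j
  have "\<forall>\<^sub>F k in sequentially. norm (B k j *v s k - G j *v s k) \<le> \<epsilon> * norm (s k)"
    by (rule Dennis_More_of_curvature_defect[OF hess_pos B_pos s_nz defect_tendsto \<epsilon>])
  then show "\<forall>\<^sub>F k in sequentially. norm (B k j *v d k - G j *v d k) \<le> \<epsilon> * norm (d k)"
  proof eventually_elim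
    case (elim k)
    have "B k j *v s k - G j *v s k = \<alpha> k *\<^sub>R (B k j *v d k - G j *v d k)"
      by (simp add: s_eq matrix_vector_mult_scaleR scaleR_diff_right)
    then have "\<alpha> k * norm (B k j *v d k - G j *v d k) \<le> \<alpha> k * (\<epsilon> * norm (d k))"
      using elim \<alpha>_pos[of k] by (simp add: norm_s mult_ac)
    then show ?case
      using \<alpha>_pos[of k] by (simp add: mult_le_cancel_left)
  qed
qed

lemma inner_diff_le_of_norm_le:
  fixes u v w :: "real^'n"
  assumes "norm (u - v) \<le> \<epsilon> * norm w" shows "\<bar>w \<bullet> u - w \<bullet> v\<bar> \<le> \<epsilon> * (norm w)\<^sup>2"
proof -
  have "\<bar>w \<bullet> (u - v)\<bar> \<le> norm w * norm (u - v)"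
    by (rule Cauchy_Schwarz_ineq2)
  also have "\<dots> \<le> norm w * (\<epsilon> * norm w)"
    using assms by (intro mult_left_mono) auto
  finally show ?thesis
    by (simp add: inner_diff_right power2_eq_square mult_ac)
qed

lemma eventually_B_lower_bound:
  "\<forall>\<^sub>F k in sequentially. \<forall>j. m / 2 * (norm (d k))\<^sup>2 \<le> d k \<bullet> (B k j *v d k)"
proof -
  have "\<forall>\<^sub>F k in sequentially. \<forall>j. norm (B k j *v d k - G j *v d k) \<le> m / 2 * norm (d k)"
    using m by (intro eventually_Dennis_More) auto
  then show ?thesis
  proof eventually_elim
    case (elim k)
    show ?case
    proof
      fix j
      show "m / 2 * (norm (d k))\<^sup>2 \<le> d k \<bullet> (B k j *v d k)"
        using inner_diff_le_of_norm_le[OF elim[rule_format, of j]] m(2)[of "d k" j] by linarith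
    qed
  qed
qed

text \<open>The direction is the step divided by the step length, and step lengths stay away from \<open>0\<close>. This is
  needed before unit steps can be examined, as \<open>x + d\<close> has to be close to the limit.\<close>

lemma d_tendsto: "d \<longlonglongrightarrow> 0"
proof -
  obtain c where c: "0 < c"
    "\<forall>\<^sub>F k in sequentially. (\<forall>j. m / 2 * (norm (d k))\<^sup>2 \<le> d k \<bullet> (B k j *v d k)) \<longrightarrow> c \<le> \<alpha> k"
    using eventually_step_length_ge[of "m / 2"] m by auto
  have "\<forall>\<^sub>F k in sequentially. norm (d k) \<le> norm (s k) / c"
    using c(2) eventually_B_lower_bound
  proof eventually_elim
    case (elim k)
    then have "c * norm (d k) \<le> norm (s k)"
      unfolding norm_s by (intro mult_right_mono) auto
    then show ?case
      using c(1) by (simp add: field_simps)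
  qed
  moreover have "s \<longlonglongrightarrow> 0"
    using tendsto_diff[OF x_Suc_tendsto conv] by (simp add: step_s_def [abs_def])
  then have "(\<lambda>k. norm (s k) / c) \<longlonglongrightarrow> 0"
    using c(1) by (intro tendsto_eq_intros tendsto_norm_zero) auto
  ultimately show ?thesis
    by (rule Lim_null_comparison)
qed

lemma eventually_model_error_full_step:
  assumes "0 < \<epsilon>"
  shows "\<forall>\<^sub>F k in sequentially. model_error_le \<epsilon> (x k + d k) (x k)"
  using tendsto_add[OF conv d_tendsto] conv by (intro eventually_model_error_le[OF assms]) simp_all

text \<open>With \<open>Q = \<Sum>\<^sub>j l\<^sub>j d\<^sup>T B\<^sub>j d\<close> one has \<open>- Q \<le> slope \<le> - m / 4 \<parallel>d\<parallel>\<^sup>2\<close>. After replacing \<open>G\<^sub>j\<close> by \<open>B\<^sub>j\<close>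
  the full step changes every objective by at most \<open>- Q / 2 + o(\<parallel>d\<parallel>\<^sup>2)\<close>, which is below \<open>- \<rho> Q\<close> as
  \<open>\<rho> < 1/2\<close>. At its end the multipliers combine the directional derivatives to
  \<open>o(\<parallel>d\<parallel>\<^sup>2)\<close>, which exceeds \<open>\<sigma> slope\<close>.\<close>

lemma eventually_unit_step: "\<forall>\<^sub>F k in sequentially. admissible_step F \<rho> \<sigma> (x k) (d k) 1"
proof -
  define \<epsilon> where "\<epsilon> = min ((1 / 2 - \<rho>) * m / 3) (\<sigma> * m / 8)"
  have \<epsilon>: "0 < \<epsilon>" "3 / 2 * \<epsilon> \<le> (1 / 2 - \<rho>) * (m / 2)" "2 * \<epsilon> \<le> \<sigma> * (m / 4)"
    using rho sigma m by (auto simp: \<epsilon>_def min_def)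
  show ?thesis
    using eventually_model_error_full_step[OF \<epsilon>(1)] eventually_Dennis_More[OF \<epsilon>(1)] eventually_B_lower_bound
  proof eventually_elim
    case (elim k)
    let ?n = "(norm (d k))\<^sup>2"
    obtain l where l: "\<And>j. 0 \<le> l j" "sum l UNIV = 1"
      "(\<Sum>j\<in>UNIV. l j *\<^sub>R (g j (x k) + B k j *v d k)) = 0"
      "- (\<Sum>j\<in>UNIV. l j * (d k \<bullet> (B k j *v d k))) \<le> slope k"
      "\<And>i. g i (x k) \<bullet> d k + 1/2 * (d k \<bullet> (B k i *v d k)) \<le> - 1/2 * (\<Sum>j\<in>UNIV. l j * (d k \<bullet> (B k j *v d k)))"
      by (rule multipliers[OF B_pos, of k]) (rule that)
    define Q where "Q = (\<Sum>j\<in>UNIV. l j * (d k \<bullet> (B k j *v d k)))"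
    have Q: "m / 2 * ?n \<le> Q"
      unfolding Q_def using elim(3) by (intro convex_comb_ge[OF l(1,2)]) auto
    have BG: "\<bar>d k \<bullet> (B k j *v d k) - d k \<bullet> (G j *v d k)\<bar> \<le> \<epsilon> * ?n" for j
      using elim(2) by (intro inner_diff_le_of_norm_le) auto
    have "F (x k + d k) $ j \<le> F (x k) $ j + \<rho> * slope k" for j
    proof -
      have "\<bar>F (x k + d k) $ j - F (x k) $ j - g j (x k) \<bullet> d k - 1/2 * (d k \<bullet> (G j *v d k))\<bar> \<le> \<epsilon> * ?n"
        using elim(1) by (simp add: model_error_le_def)
      then have "F (x k + d k) $ j - F (x k) $ j \<le> - 1/2 * Q + 3 / 2 * \<epsilon> * ?n"
        using BG[of j] l(5)[of j] unfolding Q_def by linarith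
      also have "3 / 2 * \<epsilon> * ?n \<le> (1 / 2 - \<rho>) * (m / 2) * ?n"
        using \<epsilon> by (intro mult_right_mono) auto
      also have "\<dots> = (1 / 2 - \<rho>) * (m / 2 * ?n)"
        by simp
      also have "\<dots> \<le> (1 / 2 - \<rho>) * Q"
        using rho Q by (intro mult_left_mono) auto
      also have "- 1/2 * Q + (1 / 2 - \<rho>) * Q = \<rho> * - Q"
        by (simp add: algebra_simps)
      also have "\<dots> \<le> \<rho> * slope k"
        using l(4) rho by (intro mult_left_mono) (auto simp: Q_def)
      finally show ?thesis
        by simp
    qed
    moreover have "\<sigma> * slope k \<le> maxdir F (x k + d k) (d k)"
    proof -
      have "slope k \<le> - (m / 2 / 2 * ?n)"
        using elim(3) by (intro slope_le) auto
      then have "\<sigma> * slope k \<le> \<sigma> * - (m / 2 / 2 * ?n)"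
        using sigma rho by (intro mult_left_mono) auto
      also have "\<dots> = - (\<sigma> * (m / 4) * ?n)"
        by simp
      also have "\<dots> \<le> - (2 * \<epsilon> * ?n)"
        using mult_right_mono[OF \<epsilon>(3), of ?n] by simp
      also have "\<dots> = (\<Sum>j\<in>UNIV. l j *\<^sub>R (g j (x k) + B k j *v d k)) \<bullet> d k - 2 * \<epsilon> * ?n"
        by (simp only: l(3) inner_zero_left)
      also have "\<dots> = (\<Sum>j\<in>UNIV. l j * (g j (x k) \<bullet> d k + d k \<bullet> (B k j *v d k) - 2 * \<epsilon> * ?n))"
        using l(2) by (simp add: inner_sum_left inner_add_left right_diff_distrib sum_subtractf
            inner_commute[of "d k"] flip: sum_distrib_right)
      also have "\<dots> \<le> (\<Sum>j\<in>UNIV. l j * maxdir F (x k + d k) (d k))"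
      proof (intro sum_mono mult_left_mono l(1))
        fix j
        have "norm (g j (x k + d k) - (g j (x k) + G j *v d k)) \<le> \<epsilon> * norm (d k)"
          using elim(1) by (simp add: model_error_le_def diff_diff_eq)
        then have "\<bar>d k \<bullet> g j (x k + d k) - d k \<bullet> (g j (x k) + G j *v d k)\<bar> \<le> \<epsilon> * ?n"
          by (rule inner_diff_le_of_norm_le)
        then have "\<bar>g j (x k + d k) \<bullet> d k - (g j (x k) \<bullet> d k + d k \<bullet> (G j *v d k))\<bar> \<le> \<epsilon> * ?n"
          by (simp add: inner_add_right inner_commute)
        then have "g j (x k) \<bullet> d k + d k \<bullet> (B k j *v d k) - 2 * \<epsilon> * ?n \<le> g j (x k + d k) \<bullet> d k"
          using BG[of j] by linarith
        also have "\<dots> \<le> maxdir F (x k + d k) (d k)"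
          by (rule cgrad_le_maxdir)
        finally show "g j (x k) \<bullet> d k + d k \<bullet> (B k j *v d k) - 2 * \<epsilon> * ?n \<le> maxdir F (x k + d k) (d k)" .
      qed
      also have "\<dots> = maxdir F (x k + d k) (d k)"
        using l(2) by (simp flip: sum_distrib_right)
      finally show ?thesis .
    qed
    ultimately show ?case
      by (simp add: admissible_step_def)
  qed
qed

text \<open>The multipliers of iteration \<open>k\<close> are applied to the gradients at \<open>x (Suc k)\<close>: the linearization of their
  combination vanishes by stationarity up to the Dennis--More error, so the gap at
  \<open>x (Suc k)\<close> is \<open>o(\<parallel>s k\<parallel>\<^sup>2)\<close>, and it bounds \<open>\<parallel>s (Suc k)\<parallel>\<^sup>2\<close>.\<close>

lemma eventually_next_step_le:
  assumes \<eta>: "0 < \<eta>"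
  shows "\<forall>\<^sub>F k in sequentially. norm (x (Suc (Suc k)) - x (Suc k)) \<le> \<eta> * norm (x (Suc k) - x k)"
proof -
  \<comment> \<open>chosen such that \<open>4 / (m \<rho>) * (2 \<epsilon>)\<^sup>2 / m = \<eta>\<^sup>2\<close>\<close>
  define \<epsilon> where "\<epsilon> = \<eta> * m * sqrt \<rho> / 4"
  have \<epsilon>: "0 < \<epsilon>"
    using \<eta> m rho by (simp add: \<epsilon>_def)
  show ?thesis
    using eventually_model_error_full_step[OF \<epsilon>] eventually_Dennis_More[OF \<epsilon>] eventually_unit_step
      eventually_step_le_gap[THEN eventually_sequentially_Suc[THEN iffD2]]
      eventually_gap_le_grad[THEN eventually_sequentially_Suc[THEN iffD2]]
  proof eventually_elim
    case (elim k)
    have x': "x (Suc k) = x k + d k" and s: "s k = d k"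
      using unit_step_first[OF elim(3)] by (simp_all add: x_Suc s_eq)
    obtain l where l: "\<And>j. 0 \<le> l j" "sum l UNIV = 1"
      "(\<Sum>j\<in>UNIV. l j *\<^sub>R (g j (x k) + B k j *v d k)) = 0"
      by (rule multipliers[OF B_pos, of k]) (rule that)
    have "(\<Sum>j\<in>UNIV. l j *\<^sub>R g j (x (Suc k)))
        = (\<Sum>j\<in>UNIV. l j *\<^sub>R g j (x (Suc k))) - (\<Sum>j\<in>UNIV. l j *\<^sub>R (g j (x k) + B k j *v d k))"
      by (simp only: l(3) diff_zero)
    also have "\<dots> = (\<Sum>j\<in>UNIV. l j *\<^sub>R (g j (x (Suc k)) - (g j (x k) + B k j *v d k)))"
      by (simp add: scaleR_diff_right sum_subtractf)
    finally have "norm (\<Sum>j\<in>UNIV. l j *\<^sub>R g j (x (Suc k)))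
        \<le> (\<Sum>j\<in>UNIV. norm (l j *\<^sub>R (g j (x (Suc k)) - (g j (x k) + B k j *v d k))))"
      by (simp only: norm_sum)
    also have "\<dots> = (\<Sum>j\<in>UNIV. l j * norm (g j (x (Suc k)) - (g j (x k) + B k j *v d k)))"
      using l(1) by simp
    also have "\<dots> \<le> 2 * \<epsilon> * norm (d k)"
    proof (rule convex_comb_le[OF l(1,2)])
      fix j
      have "g j (x (Suc k)) - (g j (x k) + B k j *v d k)
          = (g j (x k + d k) - g j (x k) - G j *v d k) - (B k j *v d k - G j *v d k)"
        by (simp add: x')
      then have "norm (g j (x (Suc k)) - (g j (x k) + B k j *v d k))
          \<le> norm (g j (x k + d k) - g j (x k) - G j *v d k) + norm (B k j *v d k - G j *v d k)"
        by (metis norm_triangle_ineq4)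
      also have "\<dots> \<le> \<epsilon> * norm (d k) + \<epsilon> * norm (d k)"
        using elim(1,2) by (intro add_mono) (auto simp: model_error_le_def)
      finally show "norm (g j (x (Suc k)) - (g j (x k) + B k j *v d k)) \<le> 2 * \<epsilon> * norm (d k)"
        by simp
    qed
    finally have "(norm (\<Sum>j\<in>UNIV. l j *\<^sub>R g j (x (Suc k))))\<^sup>2 / m \<le> (2 * \<epsilon> * norm (d k))\<^sup>2 / m"
      using m by (intro divide_right_mono power_mono) auto
    then have "gap (x (Suc k)) \<le> (2 * \<epsilon> * norm (d k))\<^sup>2 / m"
      using elim(5) l(1,2) order_trans by blast
    then have "4 / (m * \<rho>) * gap (x (Suc k)) \<le> 4 / (m * \<rho>) * ((2 * \<epsilon> * norm (d k))\<^sup>2 / m)"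
      using m rho by (intro mult_left_mono) auto
    also have "\<dots> = (\<eta> * norm (s k))\<^sup>2"
      using m rho by (simp add: \<epsilon>_def s power_mult_distrib power_divide) (simp add: field_simps power2_eq_square)
    finally have "(norm (s (Suc k)))\<^sup>2 \<le> (\<eta> * norm (s k))\<^sup>2"
      using elim(4) by linarith
    then have "norm (s (Suc k)) \<le> \<eta> * norm (s k)"
      by (rule power2_le_imp_le) (use \<eta> in simp)
    then show ?case
      by (simp add: step_s_def)
  qed
qed

lemma superlinear_convergence: "(\<lambda>k. norm (x (Suc k) - xstar) / norm (x k - xstar)) \<longlonglongrightarrow> 0"
  by (rule superlinear_convergence_of_steps[OF conv eventually_next_step_le])

end

theorem theorem4p3:
  fixes F :: "real^'n \<Rightarrow> real^'m"
    and \<rho> \<sigma> \<theta>min \<theta>max :: real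
    and x d :: "nat \<Rightarrow> real^'n"
    and B :: "nat \<Rightarrow> 'm \<Rightarrow> real^'n^'n"
    and \<alpha> \<theta> :: "nat \<Rightarrow> real"
    and \<mu> :: "nat \<Rightarrow> real^'m"
    and xstar :: "real^'n"
  assumes C2: "\<And>j. twice_cont_differentiable (\<lambda>z. F z $ j)"
    and rho: "0 < \<rho>" "\<rho> < 1/2"
    and sigma: "\<rho> < \<sigma>" "\<sigma> < 1"
    and theta: "0 < \<theta>min" "\<theta>min \<le> \<theta>max"
    and run: "bfgs_run F \<rho> \<sigma> \<theta>min \<theta>max x B d \<alpha> \<mu> \<theta>"
    and conv: "x \<longlonglongrightarrow> xstar"
    and opt: "local_pareto_optimal F xstar"
    and hess_pos: "\<And>j. pos_def (chess F j xstar)"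
    and holder: "\<exists>\<nu> M. 0 < \<nu> \<and> \<nu> \<le> 1 \<and> 0 < M \<and>
       (\<forall>\<^sub>F z in nhds xstar. \<forall>j.
          matrix_onorm (chess F j z - chess F j xstar) \<le> M * norm (z - xstar) powr \<nu>)"
    and summ: "\<And>j. summable (\<lambda>k. reg_r F x \<mu> \<theta> k j)"
  shows "(\<forall>\<^sub>F k in sequentially.
            (\<forall>j. F (x k + d k) $ j \<le> F (x k) $ j + \<rho> * maxdir F (x k) (d k)) \<and>
            maxdir F (x k + d k) (d k) \<ge> \<sigma> * maxdir F (x k) (d k)) \<and>
         (\<lambda>k. norm (x (Suc k) - xstar) / norm (x k - xstar)) \<longlonglongrightarrow> 0"
proof -
  obtain m where m: "0 < m" "\<And>j v. m * (norm v)\<^sup>2 \<le> v \<bullet> (chess F j xstar *v v)"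
    using pos_defs_lower_bound[of "\<lambda>j. chess F j xstar"] hess_pos by blast
  obtain \<nu> M where "0 < \<nu>" "0 < M" "\<forall>\<^sub>F z in nhds xstar. \<forall>j.
      matrix_onorm (chess F j z - chess F j xstar) \<le> M * norm (z - xstar) powr \<nu>"
    using holder by blast
  then interpret convergent_bfgs_run F \<rho> \<sigma> \<theta>min \<theta>max x d B \<alpha> \<theta> \<mu> xstar m \<nu> M
    using C2 rho sigma theta(1) run conv hess_pos m summ by unfold_locales
  show ?thesis
    using eventually_unit_step superlinear_convergence by (simp add: admissible_step_def)
qed

end
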